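(* Let $\Gamma$ be a group acting on $\Omega$ with invariant measure $\mu$ as described in the context, and let $A\subseteq \Omega$ be a domain of expansion. Then the following holds. (i) A subset $B\subseteq\Omega$ is essentially Borel equidecomposable to $A$ if and only if $A$ and $B$ essentially cover each other, $B$ is measurable and $\mu(A)=\mu(B)$. (ii) A subset $B\subseteq\Omega$ is measurably equidecomposable to $A$ if and only if $A$ and $B$ are set-theoretically equidecomposable, $B$ is measurable and $\mu(A)=\mu(B)$.
   Context: Setting: $\Gamma$ is a group, $(\Omega,\tau)$ is a Polish topological space with Borel $\sigma$-algebra $\mathcal{B}$, and $a:\Gamma\curvearrowright\Omega$ is a left action by Borel automorphisms. $\mu$ is a $\sigma$-finite measure on $(\Omega,\mathcal{B})$ which is non-zero on all non-empty open sets, and the action preserves $\mu$. Write $\gamma.U=\{\gamma.u: u\in U\}$ and $T.U=\bigcup_{\gamma\in T}\gamma.U$ for $\gamma\in\Gamma$, $T\subseteq\Gamma$, $U\subseteq\Omega$. $\mathcal{B}_\mu$ denotes the completion of $\mathcal{B}$ with respect to $\mu$; its elements are called measurable. $A$ covers $B$ if there is a finite $T\subseteq\Gamma$ with $B\subseteq T.A$. $A$ essentially covers $B$ if $A$ covers $B\setminus N$ for some $\mu$-null set $N$. For a family $\mathcal{A}\subseteq 2^\Omega$ invariant under the action, sets $A,B\subseteq\Omega$ are $\mathcal{A}$-equidecomposable if there are $m\in\mathbb{N}$, $\gamma_1,\dots,\gamma_m\in\Gamma$ and a partition $A=A_1\sqcup\dots\sqcup A_m$ with each $A_i\in\mathcal{A}$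 such that $\gamma_1.A_1,\dots,\gamma_m.A_m$ partition $B$. For $\mathcal{A}=\mathcal{B},\ \mathcal{B}_\mu,\ 2^\Omega$ this is called Borel, measurable, and set-theoretic equidecomposability, respectively. Sets $A,B$ are essentially Borel equidecomposable if they are measurable and there are $\mu$-null sets $N,N'$ such that $A\setminus N$ and $B\setminus N'$ are Borel equidecomposable. A set $C\in\mathcal{B}_\mu$ is a domain of expansion if $0<\mu(C)<\infty$ and for every real $\eta>0$ there is a finite set $R\subseteq\Gamma$ such that for all measurable $Y\subseteq C$ we have $\mu((R.Y)\cap C)\ge\min\left((1-\eta)\mu(C),\ \mu(Y)/\eta\right)$. *)

theory Defs
  imports "HOL-Analysis.Analysis" "HOL-Algebra.Group_Action"
begin

text \<open>
  The Polish space \<open>\<Omega>\<close> is a type of class \<open>polish_space\<close>, and \<open>\<Gamma>\<close> is a (not necessarily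
  countable) group \<open>G\<close> acting through \<open>\<phi>\<close>.  The measure \<open>M\<close> lives on the Borel sets;
  \<open>\<B>\<^sub>\<mu>\<close> is \<open>sets (completion M)\<close>, and null sets are those of \<open>completion M\<close>.
\<close>

text \<open>
  Measurability of the inverse of \<open>\<phi> g\<close>, i.e. that \<open>\<phi> g\<close> is a Borel automorphism, is measurability
  of \<open>\<phi> (inv g)\<close>.
\<close>

locale borel_measure_preserving_action =
  group_action G UNIV \<phi> + sigma_finite_measure M
  for G :: "('g, 'b) monoid_scheme" (structure)
    and \<phi> :: "'g \<Rightarrow> 'a::polish_space \<Rightarrow> 'a"
    and M :: "'a measure" +
  assumes sets_M: "sets M = sets borel"
    and borel_action: "g \<in> carrier G \<Longrightarrow> \<phi> g \<in> borel_measurable borel"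
    and measure_preserving:
      "g \<in> carrier G \<Longrightarrow> U \<in> sets borel \<Longrightarrow> emeasure M (\<phi> g ` U) = emeasure M U"
    and open_nonzero: "open U \<Longrightarrow> U \<noteq> {} \<Longrightarrow> emeasure M U \<noteq> 0"

definition translates :: "('g \<Rightarrow> 'a \<Rightarrow> 'a) \<Rightarrow> 'g set \<Rightarrow> 'a set \<Rightarrow> 'a set" where
  "translates \<phi> T U = (\<Union>g\<in>T. \<phi> g ` U)"

definition covers ::
  "('g, 'b) monoid_scheme \<Rightarrow> ('g \<Rightarrow> 'a \<Rightarrow> 'a) \<Rightarrow> 'a set \<Rightarrow> 'a set \<Rightarrow> bool" where
  "covers G \<phi> A B \<longleftrightarrow> (\<exists>T. finite T \<and> T \<subseteq> carrier G \<and> B \<subseteq> translates \<phi> T A)"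

definition essentially_covers ::
  "('g, 'b) monoid_scheme \<Rightarrow> ('g \<Rightarrow> 'a \<Rightarrow> 'a) \<Rightarrow> 'a measure \<Rightarrow> 'a set \<Rightarrow> 'a set \<Rightarrow> bool" where
  "essentially_covers G \<phi> M A B \<longleftrightarrow> (\<exists>N\<in>null_sets (completion M). covers G \<phi> A (B - N))"

definition equidecomposable ::
  "('g, 'b) monoid_scheme \<Rightarrow> ('g \<Rightarrow> 'a \<Rightarrow> 'a) \<Rightarrow> 'a set set \<Rightarrow> 'a set \<Rightarrow> 'a set \<Rightarrow> bool" where
  "equidecomposable G \<phi> \<A> A B \<longleftrightarrow>
    (\<exists>(m::nat) (\<gamma> :: nat \<Rightarrow> 'g) (P :: nat \<Rightarrow> 'a set).
      (\<forall>i<m. \<gamma> i \<in> carrier G \<and> P i \<in> \<A>) \<and>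
      disjoint_family_on P {..<m} \<and> (\<Union>i<m. P i) = A \<and>
      disjoint_family_on (\<lambda>i. \<phi> (\<gamma> i) ` P i) {..<m} \<and> (\<Union>i<m. \<phi> (\<gamma> i) ` P i) = B)"

definition borel_equidecomposable ::
  "('g, 'b) monoid_scheme \<Rightarrow> ('g \<Rightarrow> 'a::topological_space \<Rightarrow> 'a) \<Rightarrow> 'a set \<Rightarrow> 'a set \<Rightarrow> bool" where
  "borel_equidecomposable G \<phi> = equidecomposable G \<phi> (sets borel)"

definition measurably_equidecomposable ::
  "('g, 'b) monoid_scheme \<Rightarrow> ('g \<Rightarrow> 'a \<Rightarrow> 'a) \<Rightarrow> 'a measure \<Rightarrow> 'a set \<Rightarrow> 'a set \<Rightarrow> bool" where
  "measurably_equidecomposable G \<phi> M = equidecomposable G \<phi> (sets (completion M))"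

definition set_equidecomposable ::
  "('g, 'b) monoid_scheme \<Rightarrow> ('g \<Rightarrow> 'a \<Rightarrow> 'a) \<Rightarrow> 'a set \<Rightarrow> 'a set \<Rightarrow> bool" where
  "set_equidecomposable G \<phi> = equidecomposable G \<phi> UNIV"

definition essentially_borel_equidecomposable ::
  "('g, 'b) monoid_scheme \<Rightarrow> ('g \<Rightarrow> 'a::topological_space \<Rightarrow> 'a) \<Rightarrow> 'a measure
    \<Rightarrow> 'a set \<Rightarrow> 'a set \<Rightarrow> bool" where
  "essentially_borel_equidecomposable G \<phi> M A B \<longleftrightarrow>
    A \<in> sets (completion M) \<and> B \<in> sets (completion M) \<and>
    (\<exists>N\<in>null_sets (completion M). \<exists>N'\<in>null_sets (completion M).
      borel_equidecomposable G \<phi> (A - N) (B - N'))"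

text \<open>
  Since \<open>C\<close> has finite measure, the real-valued \<open>measure\<close> below loses nothing.
\<close>

definition domain_of_expansion ::
  "('g, 'b) monoid_scheme \<Rightarrow> ('g \<Rightarrow> 'a \<Rightarrow> 'a) \<Rightarrow> 'a measure \<Rightarrow> 'a set \<Rightarrow> bool" where
  "domain_of_expansion G \<phi> M C \<longleftrightarrow>
    C \<in> sets (completion M) \<and>
    0 < emeasure (completion M) C \<and> emeasure (completion M) C < \<infinity> \<and>
    (\<forall>\<eta>::real. \<eta> > 0 \<longrightarrow>
      (\<exists>R. finite R \<and> R \<subseteq> carrier G \<and>
        (\<forall>Y\<in>sets (completion M). Y \<subseteq> C \<longrightarrow>
          measure (completion M) (translates \<phi> R Y \<inter> C)
            \<ge> min ((1 - \<eta>) * measure (completion M) C) (measure (completion M) Y / \<eta>))))"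

end

theory Submission
  imports Defs
begin

text \<open>
  The necessity of the conditions is elementary. For sufficiency, one looks for finitely many
  group elements \<open>S\<close> and an injective partial map \<open>B \<rightharpoonup> A\<close> that moves every point by an element of
  \<open>S\<close>, is defined almost everywhere and misses only a null set: a measurable perfect matching in
  the bipartite graph between \<open>B\<close> and \<open>A\<close> in which \<open>x\<close> is joined to \<open>\<phi> g x\<close> for \<open>g \<in> S\<close>. If \<open>A\<close>
  and \<open>B\<close> cover each other, a set can be pushed from one to the other with only a bounded loss of measure, so that the
  expansion of \<open>A\<close> carries over to this graph in both directions
  (\<open>expanding_between_covering_sets\<close>).

  Let \<open>u\<close> be the measure of the points that a matching leaves out. Starting from the unmatched
  points of \<open>B\<close>, the set reached by alternating walks doubles its measure until it fills most of
  \<open>B\<close>, after which its complement halves; the complement cannot drop below \<open>u\<close>, so a walk of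
  length \<open>O(log (1/u))\<close> ends in an unmatched point of \<open>A\<close> (\<open>reach_unmatched\<close>). Augmenting along
  such walks of length \<open>l\<close> alters the matching on a set of measure at most \<open>l\<close> times the gain
  (\<open>augment\<close>). The walks of one augmentation have to be disjoint, and this comes for free: all of
  them use the same word, so the walks are determined by their end points, and the points of a
  walk lie in different levels of the search.

  Since \<open>O(log (1/u))\<close> is bounded by a multiple of \<open>1 / sqrt u\<close>, which is integrable at \<open>0\<close>, an
  augmentation costs at most a multiple of the decrease of \<open>sqrt u\<close> (\<open>improve\<close>). Hence, along any
  sequence of augmentations, the total alteration is finite and the matchings converge almost
  everywhere (\<open>cheaper_eventual_value\<close>). The ordering principle of Brezis and Browder now yields
  a matching that cannot be improved, and such a matching has \<open>u = 0\<close> (\<open>perfect_matching\<close>).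

  Shrinking the pieces of this matching to Borel sets of the same measure gives the essential
  Borel equidecomposition. For a measurable equidecomposition of all of \<open>A\<close> and \<open>B\<close>, the exceptional
  null set is enlarged to a null set that is invariant under the finitely many group elements in
  use; on it, the given set-theoretic equidecomposition takes over, whose pieces are then null
  and hence measurable.
\<close>

section \<open>Maximal elements of preordered sets whose increasing sequences are bounded\<close>

text \<open>
  The ordering principle of Brezis and Browder. Take a sequence in which every step loses at least
  half of what can still be lost above the current element. Everything above an upper
  bound of the sequence was reachable from each of its elements, so it cannot have a smaller value.
\<close>

lemma brezis_browder:
  fixes le :: "'s \<Rightarrow> 's \<Rightarrow> bool" and u :: "'s \<Rightarrow> real"
  assumes start: "P a"
    and refl: "\<And>x. P x \<Longrightarrow> le x x"
    and trans: "\<And>x y z. P x \<Longrightarrow> P y \<Longrightarrow> P z \<Longrightarrow> le x y \<Longrightarrow> le y z \<Longrightarrow> le x z"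
    and antimono: "\<And>x y. P x \<Longrightarrow> P y \<Longrightarrow> le x y \<Longrightarrow> u y \<le> u x"
    and nonneg: "\<And>x. P x \<Longrightarrow> 0 \<le> u x"
    and chain: "\<And>s. (\<And>n::nat. P (s n)) \<Longrightarrow> (\<And>n. le (s n) (s (Suc n)))
      \<Longrightarrow> \<exists>y. P y \<and> (\<forall>n. le (s n) y)"
  obtains x where "P x" and "\<And>y. P y \<Longrightarrow> le x y \<Longrightarrow> u y = u x"
proof -
  define I where "I x = Inf (u ` {y. P y \<and> le x y})" for x
  have I_le: "I x \<le> u y" if "P y" "le x y" for x y
    unfolding I_def using that nonneg
    by (intro cInf_lower) (auto intro!: bdd_belowI2[where m = 0])
  have step: "\<exists>y. P y \<and> le x y \<and> u y \<le> (u x + I x) / 2" if x: "P x" for x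
  proof (cases "I x < u x")
    case True
    then have less: "Inf (u ` {y. P y \<and> le x y}) < (u x + I x) / 2"
      by (simp add: I_def)
    have "u ` {y. P y \<and> le x y} \<noteq> {}"
      using x refl by blast
    from cInf_lessD[OF this less] obtain y where "P y" "le x y" "u y < (u x + I x) / 2"
      by blast
    then show ?thesis by (auto intro: less_imp_le)
  next
    case False
    then show ?thesis using x refl by (intro exI[of _ x]) auto
  qed
  have "\<exists>s. \<forall>n::nat. P (s n) \<and> le (s n) (s (Suc n)) \<and> u (s (Suc n)) \<le> (u (s n) + I (s n)) / 2"
    using start step by (intro dependent_nat_choice) auto
  then obtain s where s: "P (s n)" "le (s n) (s (Suc n))" "u (s (Suc n)) \<le> (u (s n) + I (s n)) / 2"
    for n :: nat by blast
  obtain y where y: "P y" "\<And>n. le (s n) y"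
    using chain[of s] s by blast
  show thesis
  proof (rule that[OF y(1)])
    fix z assume z: "P z" "le y z"
    have "le (s n) z" for n
      using trans y z s(1) by blast
    then have Iz: "I (s n) \<le> u z" for n
      using I_le z by blast
    have gap: "u (s n) - u z \<le> (u (s 0) - u z) * (1/2) ^ n" for n
    proof (induction n)
      case (Suc n)
      have "u (s (Suc n)) - u z \<le> (u (s n) - u z) / 2"
        using s(3)[of n] Iz[of n] by (simp add: field_simps)
      also have "\<dots> \<le> (u (s 0) - u z) * (1/2) ^ n / 2"
        using Suc by simp
      finally show ?case by simp
    qed simp
    have "(\<lambda>n. (u (s 0) - u z) * (1/2) ^ n) \<longlonglongrightarrow> (u (s 0) - u z) * 0"
      by (intro tendsto_intros) auto
    moreover have "u y - u z \<le> (u (s 0) - u z) * (1/2) ^ n" for n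
      using gap[of n] antimono[OF s(1) y(1) y(2)[of n]] by linarith
    ultimately have "u y - u z \<le> (u (s 0) - u z) * 0"
      by (intro LIMSEQ_le_const) auto
    then show "u z = u y"
      using antimono[OF y(1) z] by linarith
  qed
qed

section \<open>Groups acting by measure preserving bijections\<close>

locale measure_preserving_action = group_action G UNIV \<phi>
  for G :: "('g, 'b) monoid_scheme" (structure)
    and \<phi> :: "'g \<Rightarrow> 'a \<Rightarrow> 'a"
    and \<mu> :: "'a measure" +
  assumes space_UNIV: "space \<mu> = UNIV"
    and sets_image: "g \<in> carrier G \<Longrightarrow> U \<in> sets \<mu> \<Longrightarrow> \<phi> g ` U \<in> sets \<mu>"
    and emeasure_image: "g \<in> carrier G \<Longrightarrow> U \<in> sets \<mu> \<Longrightarrow> emeasure \<mu> (\<phi> g ` U) = emeasure \<mu> U"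
begin

lemma is_group: "group G"
  using group_hom group_hom.axioms(1) by blast

lemma inv_carrier [simp, intro]: "g \<in> carrier G \<Longrightarrow> inv g \<in> carrier G"
  using is_group by (rule group.inv_closed)

lemma inj_act [simp]: "g \<in> carrier G \<Longrightarrow> inj (\<phi> g)"
  using inj_prop by simp

lemma act_eq_iff [simp]: "g \<in> carrier G \<Longrightarrow> \<phi> g x = \<phi> g y \<longleftrightarrow> x = y"
  by (rule inj_eq[OF inj_act])

lemma act_inv_act [simp]: "g \<in> carrier G \<Longrightarrow> \<phi> (inv g) (\<phi> g x) = x"
  by (rule orbit_sym_aux) auto

lemma act_act_inv [simp]: "g \<in> carrier G \<Longrightarrow> \<phi> g (\<phi> (inv g) x) = x"
  using act_inv_act[of "inv g" x] by (simp add: group.inv_inv[OF is_group])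

lemma vimage_act: "g \<in> carrier G \<Longrightarrow> \<phi> g -` U = \<phi> (inv g) ` U"
  by (auto intro: rev_image_eqI)

lemma sets_vimage_act [intro]: "g \<in> carrier G \<Longrightarrow> U \<in> sets \<mu> \<Longrightarrow> \<phi> g -` U \<in> sets \<mu>"
  by (simp add: vimage_act sets_image)

lemma measure_image: "g \<in> carrier G \<Longrightarrow> U \<in> sets \<mu> \<Longrightarrow> measure \<mu> (\<phi> g ` U) = measure \<mu> U"
  by (simp add: measure_def emeasure_image)

lemma emeasure_piecewise:
  assumes "finite I" and "\<And>i. i \<in> I \<Longrightarrow> \<gamma> i \<in> carrier G" and "\<And>i. i \<in> I \<Longrightarrow> E i \<in> sets \<mu>"
    and "disjoint_family_on E I" and "disjoint_family_on (\<lambda>i. \<phi> (\<gamma> i) ` E i) I"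
  shows "emeasure \<mu> (\<Union>i\<in>I. \<phi> (\<gamma> i) ` E i) = emeasure \<mu> (\<Union>i\<in>I. E i)"
proof -
  have "emeasure \<mu> (\<Union>i\<in>I. \<phi> (\<gamma> i) ` E i) = (\<Sum>i\<in>I. emeasure \<mu> (\<phi> (\<gamma> i) ` E i))"
    using assms by (intro sum_emeasure[symmetric]) (auto intro: sets_image)
  also have "\<dots> = (\<Sum>i\<in>I. emeasure \<mu> (E i))"
    using assms by (intro sum.cong) (auto intro: emeasure_image)
  also have "\<dots> = emeasure \<mu> (\<Union>i\<in>I. E i)"
    using assms by (intro sum_emeasure) auto
  finally show ?thesis .
qed

lemma translates_mono: "T \<subseteq> T' \<Longrightarrow> X \<subseteq> X' \<Longrightarrow> translates \<phi> T X \<subseteq> translates \<phi> T' X'"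
  by (auto simp: translates_def)

lemma sets_translates [intro]:
  "finite T \<Longrightarrow> T \<subseteq> carrier G \<Longrightarrow> X \<in> sets \<mu> \<Longrightarrow> translates \<phi> T X \<in> sets \<mu>"
  unfolding translates_def by (intro sets.finite_UN) (auto intro: sets_image)

lemma null_sets_translates:
  assumes "finite T" "T \<subseteq> carrier G" "N \<in> null_sets \<mu>"
  shows "translates \<phi> T N \<in> null_sets \<mu>"
  unfolding translates_def
  using assms by (intro null_sets.finite_UN null_setsI)
    (auto simp: emeasure_image subset_iff null_setsD1 null_setsD2 intro: sets_image)

text \<open>
  For a symmetric set of group elements, the relation of being moved into each other is symmetric,
  so translates of sets are the neighbourhoods in an undirected graph.
\<close>

lemma mem_translates_symmetric:
  assumes "T \<subseteq> carrier G" "\<And>g. g \<in> T \<Longrightarrow> inv g \<in> T"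
  shows "x \<in> translates \<phi> T X \<longleftrightarrow> (\<exists>g\<in>T. \<phi> g x \<in> X)"
proof
  assume "x \<in> translates \<phi> T X"
  then obtain g y where "g \<in> T" "y \<in> X" "x = \<phi> g y"
    by (auto simp: translates_def)
  then have "inv g \<in> T" "\<phi> (inv g) x \<in> X"
    using assms(1) by (auto intro: assms(2) simp: subset_iff)
  then show "\<exists>g\<in>T. \<phi> g x \<in> X" by blast
next
  assume "\<exists>g\<in>T. \<phi> g x \<in> X"
  then obtain g where g: "g \<in> T" "\<phi> g x \<in> X" by blast
  then have "x = \<phi> (inv g) (\<phi> g x)" using assms(1) by (simp add: subset_iff)
  then show "x \<in> translates \<phi> T X"
    unfolding translates_def using g assms(2) by blast
qed

lemma finite_symmetric_superset:
  assumes "finite T" "T \<subseteq> carrier G"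
  obtains K where "finite K" "K \<subseteq> carrier G" "T \<subseteq> K" "\<And>g. g \<in> K \<Longrightarrow> inv g \<in> K"
proof (rule that[of "T \<union> m_inv G ` T"])
  show "inv g \<in> T \<union> m_inv G ` T" if "g \<in> T \<union> m_inv G ` T" for g
    using that assms(2) by (auto simp: group.inv_inv[OF is_group] subset_iff)
qed (use assms in auto)

end

section \<open>Equidecompositions as piecewise translations\<close>

text \<open>
  An equidecomposition amounts to a bijection \<open>x \<mapsto> \<phi> (\<rho> x) x\<close> where \<open>\<rho>\<close> has finite range and its
  level sets belong to the family. Bijections are easier to invert, restrict and combine than
  families of pieces.
\<close>

lemma equidecomposableI:
  assumes "finite F" "F \<subseteq> carrier G" "\<rho> ` A \<subseteq> F"
    and "\<And>g. g \<in> F \<Longrightarrow> {x \<in> A. \<rho> x = g} \<in> \<A>"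
    and bij: "bij_betw (\<lambda>x. \<phi> (\<rho> x) x) A B"
  shows "equidecomposable G \<phi> \<A> A B"
proof -
  obtain h where h: "bij_betw h {..<card F} F"
    using ex_bij_betw_nat_finite[OF assms(1)] by (auto simp: atLeast0LessThan)
  then have hF: "h i \<in> F" if "i < card F" for i
    using that by (auto dest: bij_betwE)
  have inj: "inj_on h {..<card F}"
    using h by (rule bij_betw_imp_inj_on)
  define P where "P i = {x \<in> A. \<rho> x = h i}" for i
  have dis: "disjoint_family_on P {..<card F}"
    using inj by (auto simp: disjoint_family_on_def P_def inj_on_def)
  have "\<exists>i<card F. h i = \<rho> x" if "x \<in> A" for x
  proof -
    have "\<rho> x \<in> h ` {..<card F}"
      using h that assms(3) by (auto simp: bij_betw_def)
    then show ?thesis by auto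
  qed
  then have UN: "(\<Union>i<card F. P i) = A"
    by (fastforce simp: P_def)
  have im: "\<phi> (h i) ` P i = (\<lambda>x. \<phi> (\<rho> x) x) ` P i" for i
    by (auto simp: P_def)
  have "(\<Union>i<card F. \<phi> (h i) ` P i) = B"
    unfolding im image_UN[symmetric] UN using bij by (rule bij_betw_imp_surj_on)
  moreover have "disjoint_family_on (\<lambda>i. \<phi> (h i) ` P i) {..<card F}"
    unfolding im disjoint_family_on_def
  proof (intro ballI impI)
    fix i j assume ij: "i \<in> {..<card F}" "j \<in> {..<card F}" "i \<noteq> j"
    have "(\<lambda>x. \<phi> (\<rho> x) x) ` P i \<inter> (\<lambda>x. \<phi> (\<rho> x) x) ` P j = (\<lambda>x. \<phi> (\<rho> x) x) ` (P i \<inter> P j)"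
      by (rule inj_on_image_Int[symmetric, OF bij_betw_imp_inj_on[OF bij]]) (auto simp: P_def)
    then show "(\<lambda>x. \<phi> (\<rho> x) x) ` P i \<inter> (\<lambda>x. \<phi> (\<rho> x) x) ` P j = {}"
      using dis ij by (auto simp: disjoint_family_on_def)
  qed
  moreover have "\<forall>i<card F. h i \<in> carrier G \<and> P i \<in> \<A>"
    using hF assms(2,4) by (auto simp: P_def)
  ultimately show ?thesis
    unfolding equidecomposable_def using dis UN
    by (intro exI[of _ "card F"] exI[of _ h] exI[of _ P]) auto
qed

lemma equidecomposableE:
  assumes "equidecomposable G \<phi> \<A> A B" and inj: "\<And>g. g \<in> carrier G \<Longrightarrow> inj (\<phi> g)"
  obtains F \<rho> where "finite F" "F \<subseteq> carrier G" "\<rho> ` A \<subseteq> F" "bij_betw (\<lambda>x. \<phi> (\<rho> x) x) A B"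
proof -
  obtain m :: nat and \<gamma> P where *: "\<And>i. i < m \<Longrightarrow> \<gamma> i \<in> carrier G" "disjoint_family_on P {..<m}"
      "(\<Union>i<m. P i) = A" "disjoint_family_on (\<lambda>i. \<phi> (\<gamma> i) ` P i) {..<m}"
      "(\<Union>i<m. \<phi> (\<gamma> i) ` P i) = B"
    using assms(1) unfolding equidecomposable_def by blast
  define k where "k x = (SOME i. i < m \<and> x \<in> P i)" for x
  have k: "k x < m \<and> x \<in> P (k x)" if "x \<in> A" for x
    unfolding k_def by (rule someI_ex) (use that *(3) in auto)
  have k_eq: "k x = i" if "i < m" "x \<in> P i" for x i
    using that k[of x] *(2,3) by (auto simp: disjoint_family_on_def)
  have "inj_on (\<lambda>x. \<phi> (\<gamma> (k x)) x) A"
  proof (rule inj_onI)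
    fix x y assume xy: "x \<in> A" "y \<in> A" "\<phi> (\<gamma> (k x)) x = \<phi> (\<gamma> (k y)) y"
    then have "k x = k y"
      using *(4) k[of x] k[of y] unfolding disjoint_family_on_def by blast
    then show "x = y"
      using xy inj[OF *(1)] k[of x] by (auto dest: injD)
  qed
  moreover have "(\<lambda>x. \<phi> (\<gamma> (k x)) x) ` A = B"
  proof -
    have "(\<lambda>x. \<phi> (\<gamma> (k x)) x) ` P i = \<phi> (\<gamma> i) ` P i" if "i < m" for i
      using that by (auto simp: k_eq)
    then show ?thesis
      unfolding *(3)[symmetric] *(5)[symmetric] by (auto simp: image_UN)
  qed
  ultimately show thesis
    using *(1) k by (intro that[of "\<gamma> ` {..<m}" "\<lambda>x. \<gamma> (k x)"]) (auto simp: bij_betw_def)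
qed

context measure_preserving_action
begin

lemma set_equidecomposable_sym:
  assumes "set_equidecomposable G \<phi> A B"
  shows "set_equidecomposable G \<phi> B A"
proof -
  obtain F \<rho> where *: "finite F" "F \<subseteq> carrier G" "\<rho> ` A \<subseteq> F" "bij_betw (\<lambda>x. \<phi> (\<rho> x) x) A B"
    using assms equidecomposableE inj_act unfolding set_equidecomposable_def by metis
  define T where "T x = \<phi> (\<rho> x) x" for x
  define R where "R = inv_into A T"
  have T: "bij_betw T A B" using *(4) by (simp add: T_def[abs_def])
  then have R: "bij_betw R B A"
    unfolding R_def by (rule bij_betw_inv_into)
  have "\<phi> (inv (\<rho> (R y))) y = R y" if "y \<in> B" for y
  proof -
    have "R y \<in> A" using R that by (auto dest: bij_betwE)
    moreover have "T (R y) = y"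
      using T that unfolding R_def by (simp add: bij_betw_inv_into_right)
    ultimately show ?thesis
      using *(2,3) by (metis T_def act_inv_act image_subset_iff subsetD)
  qed
  then have "bij_betw (\<lambda>y. \<phi> (inv (\<rho> (R y))) y) B A"
    using R by (simp cong: bij_betw_cong)
  then show ?thesis
    unfolding set_equidecomposable_def using *(1-3) bij_betwE[OF R]
    by (intro equidecomposableI[where F = "m_inv G ` F"]) (auto simp: image_subset_iff)
qed

lemma equidecomposable_imp_covers:
  assumes "equidecomposable G \<phi> \<A> A B"
  shows "covers G \<phi> A B"
proof -
  obtain F \<rho> where *: "finite F" "F \<subseteq> carrier G" "\<rho> ` A \<subseteq> F" "bij_betw (\<lambda>x. \<phi> (\<rho> x) x) A B"
    using assms equidecomposableE inj_act by metis
  have "B \<subseteq> translates \<phi> F A"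
    using *(3) unfolding bij_betw_imp_surj_on[OF *(4), symmetric] translates_def by auto
  then show ?thesis
    using * unfolding covers_def by blast
qed

lemma equidecomposable_mono: "equidecomposable G \<phi> \<A> A B \<Longrightarrow> \<A> \<subseteq> \<A>' \<Longrightarrow> equidecomposable G \<phi> \<A>' A B"
  unfolding equidecomposable_def by blast

lemma covers_mono: "covers G \<phi> A B \<Longrightarrow> A \<subseteq> A' \<Longrightarrow> B' \<subseteq> B \<Longrightarrow> covers G \<phi> A' B'"
  unfolding covers_def using translates_mono by (meson order_trans subset_refl)

lemma measurable_equidecomposable_emeasure:
  assumes "equidecomposable G \<phi> (sets \<mu>) A B"
  shows "A \<in> sets \<mu>" "B \<in> sets \<mu>" "emeasure \<mu> A = emeasure \<mu> B"
proof -
  obtain m :: nat and \<gamma> P where *: "\<And>i. i < m \<Longrightarrow> \<gamma> i \<in> carrier G" "\<And>i. i < m \<Longrightarrow> P i \<in> sets \<mu>"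
      "disjoint_family_on P {..<m}" "(\<Union>i<m. P i) = A"
      "disjoint_family_on (\<lambda>i. \<phi> (\<gamma> i) ` P i) {..<m}" "(\<Union>i<m. \<phi> (\<gamma> i) ` P i) = B"
    using assms(1) unfolding equidecomposable_def by blast
  show "A \<in> sets \<mu>" "B \<in> sets \<mu>"
    using * by (auto simp flip: *(4,6) intro!: sets_image)
  show "emeasure \<mu> A = emeasure \<mu> B"
    using emeasure_piecewise[of "{..<m}" \<gamma> P] * by auto
qed

end

text \<open>
  A set in the completion is a Borel set up to a part of a Borel null set, and both are preserved
  by Borel automorphisms.
\<close>

lemma (in borel_measure_preserving_action) measure_preserving_action_completion:
  "measure_preserving_action G \<phi> (completion M)"
proof
  have sM: "space M = UNIV"
    using sets_eq_imp_space_eq[OF sets_M] by simp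
  then show "space (completion M) = UNIV" by simp
  have grp: "group G" using group_hom group_hom.axioms(1) by blast
  fix g U assume g: "g \<in> carrier G" and U: "U \<in> sets (completion M)"
  have borel_image: "\<phi> g ` V \<in> sets borel" if "V \<in> sets borel" for V
  proof -
    have ig: "inv g \<in> carrier G" using g by (simp add: grp group.inv_closed)
    have "\<phi> g ` V = \<phi> (inv g) -` V"
      using orbit_sym_aux[OF g] orbit_sym_aux[OF ig]
      by (auto simp: image_iff group.inv_inv[OF grp g]) (metis UNIV_I)
    then show ?thesis
      using measurable_sets[OF borel_action[OF ig] that] by simp
  qed
  obtain S N N' where *: "U = S \<union> N" "N \<subseteq> N'" "N' \<in> null_sets M" "S \<in> sets M"
    using U by (rule sets_completionE)
  have N': "\<phi> g ` N' \<in> null_sets M"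
    using * g borel_image measure_preserving by (auto simp: null_sets_def sets_M)
  have eq: "\<phi> g ` U = \<phi> g ` S \<union> \<phi> g ` N" using * by blast
  show "\<phi> g ` U \<in> sets (completion M)"
    unfolding eq using * N' borel_image by (intro sets_completionI[OF refl _ N']) (auto simp: sets_M)
  have n1: "\<phi> g ` N \<in> null_sets (completion M)"
    using N' * null_sets_completion_subset null_sets_completionI by (metis image_mono)
  have n2: "N \<in> null_sets (completion M)"
    using * null_sets_completion_subset null_sets_completionI by metis
  have S': "\<phi> g ` S \<in> sets M" using * borel_image by (simp add: sets_M)
  have "emeasure (completion M) (\<phi> g ` U) = emeasure (completion M) (\<phi> g ` S)"
    unfolding eq using S' n1 by (intro emeasure_Un_null_set) auto
  also have "\<dots> = emeasure (completion M) S"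
    using S' * measure_preserving[OF g, of S] by (simp add: sets_M)
  also have "\<dots> = emeasure (completion M) U"
    unfolding *(1) using n2 *(4) by (intro emeasure_Un_null_set[symmetric]) auto
  finally show "emeasure (completion M) (\<phi> g ` U) = emeasure (completion M) U" .
qed

section \<open>Matchings and their augmentation\<close>

text \<open>
  A partial map \<open>\<sigma>\<close> to the group stands for the partial map of the space that moves each \<open>x\<close> in
  its domain by \<open>\<sigma> x\<close>. Recording the group element rather than the image reduces questions of
  measurability and measure to the finitely many level sets of \<open>\<sigma>\<close>.
\<close>

definition move :: "('g \<Rightarrow> 'a \<Rightarrow> 'a) \<Rightarrow> ('a \<rightharpoonup> 'g) \<Rightarrow> 'a \<Rightarrow> 'a" where
  "move \<phi> \<sigma> x = \<phi> (the (\<sigma> x)) x"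

lemma move_Some [simp]: "\<sigma> x = Some g \<Longrightarrow> move \<phi> \<sigma> x = \<phi> g x"
  by (simp add: move_def)

lemma move_cong: "\<sigma> x = \<tau> x \<Longrightarrow> move \<phi> \<sigma> x = move \<phi> \<tau> x"
  by (simp add: move_def)

text \<open>
  The bipartite graph between \<open>C\<close> and \<open>D\<close> whose edges join \<open>x\<close> to its translates by elements of
  \<open>S\<close>. The sides may overlap; a point in both plays two roles.
\<close>

locale bipartite_action_graph = measure_preserving_action G \<phi> \<mu>
  for G :: "('g, 'b) monoid_scheme" (structure)
    and \<phi> :: "'g \<Rightarrow> 'a \<Rightarrow> 'a"
    and \<mu> :: "'a measure" +
  fixes S :: "'g set" and C D :: "'a set"
  assumes finite_S: "finite S" and S_carrier: "S \<subseteq> carrier G"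
    and S_symmetric: "g \<in> S \<Longrightarrow> inv g \<in> S"
    and C_fmeasurable: "C \<in> fmeasurable \<mu>" and D_fmeasurable: "D \<in> fmeasurable \<mu>"
    and measure_eq: "measure \<mu> C = measure \<mu> D"
begin

abbreviation nbr :: "'a set \<Rightarrow> 'a set" where
  "nbr \<equiv> translates \<phi> S"

lemma sets_C [simp, intro]: "C \<in> sets \<mu>" and sets_D [simp, intro]: "D \<in> sets \<mu>"
  using C_fmeasurable D_fmeasurable by auto

lemma S_act [simp]: "g \<in> S \<Longrightarrow> g \<in> carrier G"
  using S_carrier by blast

lemma sets_nbr [simp, intro]: "X \<in> sets \<mu> \<Longrightarrow> nbr X \<in> sets \<mu>"
  using finite_S S_carrier by (rule sets_translates)

lemma mem_nbr: "x \<in> nbr X \<longleftrightarrow> (\<exists>g\<in>S. \<phi> g x \<in> X)"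
  using S_carrier S_symmetric by (rule mem_translates_symmetric)

lemma nbr_memI: "g \<in> S \<Longrightarrow> x \<in> X \<Longrightarrow> \<phi> g x \<in> nbr X"
  by (auto simp: translates_def)

definition matching :: "('a \<rightharpoonup> 'g) \<Rightarrow> bool" where
  "matching \<sigma> \<longleftrightarrow> dom \<sigma> \<subseteq> C \<and> ran \<sigma> \<subseteq> S \<and> (\<forall>g. {x. \<sigma> x = Some g} \<in> sets \<mu>) \<and>
    inj_on (move \<phi> \<sigma>) (dom \<sigma>) \<and> move \<phi> \<sigma> ` dom \<sigma> \<subseteq> D"

definition deficiency :: "('a \<rightharpoonup> 'g) \<Rightarrow> real" where
  "deficiency \<sigma> = measure \<mu> (C - dom \<sigma>)"

lemma matchingD:
  assumes "matching \<sigma>"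
  shows "dom \<sigma> \<subseteq> C" "ran \<sigma> \<subseteq> S" "{x. \<sigma> x = Some g} \<in> sets \<mu>"
    "inj_on (move \<phi> \<sigma>) (dom \<sigma>)" "move \<phi> \<sigma> ` dom \<sigma> \<subseteq> D"
    "\<sigma> x = Some g \<Longrightarrow> g \<in> S"
  using assms by (auto simp: matching_def ran_def)

lemma dom_pieces: "matching \<sigma> \<Longrightarrow> dom \<sigma> = (\<Union>g\<in>S. {x. \<sigma> x = Some g})"
  using matchingD(6) by auto

lemma sets_dom: "matching \<sigma> \<Longrightarrow> dom \<sigma> \<in> sets \<mu>"
  by (subst dom_pieces) (auto intro!: sets.finite_UN finite_S matchingD(3))

lemma
  assumes \<sigma>: "matching \<sigma>" and E: "E \<in> sets \<mu>" "E \<subseteq> dom \<sigma>"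
  shows sets_move: "move \<phi> \<sigma> ` E \<in> sets \<mu>"
    and emeasure_move: "emeasure \<mu> (move \<phi> \<sigma> ` E) = emeasure \<mu> E"
    and measure_move: "measure \<mu> (move \<phi> \<sigma> ` E) = measure \<mu> E"
proof -
  define P where "P g = E \<inter> {x. \<sigma> x = Some g}" for g
  have P: "P g \<in> sets \<mu>" for g
    unfolding P_def using E matchingD(3)[OF \<sigma>] by blast
  have UN: "E = (\<Union>g\<in>S. P g)"
    using dom_pieces[OF \<sigma>] E(2) by (auto simp: P_def)
  have "move \<phi> \<sigma> ` P g = \<phi> g ` P g" for g
    by (auto simp: P_def image_iff)
  then have im: "move \<phi> \<sigma> ` E = (\<Union>g\<in>S. \<phi> g ` P g)"
    unfolding UN image_UN by simp
  show "move \<phi> \<sigma> ` E \<in> sets \<mu>"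
    unfolding im by (intro sets.finite_UN finite_S sets_image P) auto
  have "disjoint_family_on (\<lambda>g. \<phi> g ` P g) S"
  proof (clarsimp simp: disjoint_family_on_def P_def)
    fix g h assume "g \<in> S" "h \<in> S" "g \<noteq> h"
    have False if "x \<in> E" "y \<in> E" "\<sigma> x = Some g" "\<sigma> y = Some h" "\<phi> g x = \<phi> h y" for x y
    proof -
      have "move \<phi> \<sigma> x = move \<phi> \<sigma> y" using that by simp
      then have "x = y"
        using inj_onD[OF matchingD(4)[OF \<sigma>]] that E(2) by blast
      then show False using that \<open>g \<noteq> h\<close> by simp
    qed
    then show "\<phi> g ` (E \<inter> {x. \<sigma> x = Some g}) \<inter> \<phi> h ` (E \<inter> {x. \<sigma> x = Some h}) = {}"
      by auto
  qed
  moreover have "disjoint_family_on P S"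
    by (auto simp: disjoint_family_on_def P_def)
  ultimately show "emeasure \<mu> (move \<phi> \<sigma> ` E) = emeasure \<mu> E"
    unfolding im using emeasure_piecewise[of S "\<lambda>g. g" P] finite_S P UN by simp
  then show "measure \<mu> (move \<phi> \<sigma> ` E) = measure \<mu> E"
    by (simp add: measure_def)
qed

lemma sets_move_vimage:
  assumes \<sigma>: "matching \<sigma>" and F: "F \<in> sets \<mu>"
  shows "{x \<in> dom \<sigma>. move \<phi> \<sigma> x \<in> F} \<in> sets \<mu>"
proof -
  have "{x \<in> dom \<sigma>. move \<phi> \<sigma> x \<in> F} = (\<Union>g\<in>S. {x. \<sigma> x = Some g} \<inter> \<phi> g -` F)"
    using matchingD(6)[OF \<sigma>] by auto
  then show ?thesis
    using F by (auto intro!: sets.finite_UN finite_S sets.Int matchingD(3)[OF \<sigma>])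
qed

lemma sets_differ:
  assumes "matching \<sigma>" "matching \<tau>"
  shows "{x. \<sigma> x \<noteq> \<tau> x} \<in> sets \<mu>"
proof -
  have "{x. \<sigma> x \<noteq> \<tau> x} = (dom \<sigma> \<union> dom \<tau>) - (\<Union>g\<in>S. {x. \<sigma> x = Some g} \<inter> {x. \<tau> x = Some g})"
    using matchingD(6)[OF assms(1)] by (auto simp: domIff) (metis option.exhaust)+
  then show ?thesis
    using assms by (auto intro!: sets.finite_UN sets.Diff sets.Un sets.Int finite_S matchingD(3) sets_dom)
qed

lemma differ_subset: "matching \<sigma> \<Longrightarrow> matching \<tau> \<Longrightarrow> {x. \<sigma> x \<noteq> \<tau> x} \<subseteq> C"
  using matchingD(1)[of \<sigma>] matchingD(1)[of \<tau>] by (auto simp: subset_iff) (metis domI domIff)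

lemma fmeasurable_C: "E \<in> sets \<mu> \<Longrightarrow> E \<subseteq> C \<Longrightarrow> E \<in> fmeasurable \<mu>"
  using fmeasurableI2[OF C_fmeasurable] by blast

lemma fmeasurable_D: "E \<in> sets \<mu> \<Longrightarrow> E \<subseteq> D \<Longrightarrow> E \<in> fmeasurable \<mu>"
  using fmeasurableI2[OF D_fmeasurable] by blast

lemma measure_Diff_C: "E \<in> sets \<mu> \<Longrightarrow> E \<subseteq> C \<Longrightarrow> measure \<mu> (C - E) = measure \<mu> C - measure \<mu> E"
  by (rule measurable_measure_Diff[OF C_fmeasurable])

lemma measure_Diff_D: "E \<in> sets \<mu> \<Longrightarrow> E \<subseteq> D \<Longrightarrow> measure \<mu> (D - E) = measure \<mu> C - measure \<mu> E"
  unfolding measure_eq by (rule measurable_measure_Diff[OF D_fmeasurable])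

lemma deficiency_range:
  assumes "matching \<sigma>"
  shows "deficiency \<sigma> = measure \<mu> C - measure \<mu> (move \<phi> \<sigma> ` dom \<sigma>)"
  unfolding deficiency_def using assms matchingD(1)[OF assms]
  by (simp add: measure_Diff_C sets_dom measure_move)

lemma deficiency_nonneg: "0 \<le> deficiency \<sigma>"
  by (simp add: deficiency_def)

text \<open>
  Among finitely many translates that cover a set of positive measure, one meets it in positive
  measure. This is how a common word for a positive measure of walks is found, letter by letter.
\<close>

lemma positive_piece:
  assumes X: "X \<in> sets \<mu>" and F: "F \<in> fmeasurable \<mu>" "F \<subseteq> nbr X" "0 < measure \<mu> F"
  obtains g where "g \<in> S" "{x \<in> X. \<phi> g x \<in> F} \<in> sets \<mu>" "0 < measure \<mu> {x \<in> X. \<phi> g x \<in> F}"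
proof -
  have sets: "{x \<in> X. \<phi> g x \<in> F} \<in> sets \<mu>" if "g \<in> S" for g
  proof -
    have "{x \<in> X. \<phi> g x \<in> F} = X \<inter> \<phi> g -` F" by auto
    then show ?thesis using that X sets_vimage_act[OF S_act[OF that], of F] F(1) by auto
  qed
  have "\<exists>g\<in>S. 0 < measure \<mu> {x \<in> X. \<phi> g x \<in> F}"
  proof (rule ccontr)
    assume "\<not> ?thesis"
    then have null: "measure \<mu> {x \<in> X. \<phi> g x \<in> F} = 0" if "g \<in> S" for g
      using that by (metis measure_nonneg less_eq_real_def)
    have "F = (\<Union>g\<in>S. \<phi> g ` {x \<in> X. \<phi> g x \<in> F})"
      using F(2) unfolding translates_def by fastforce
    then have "measure \<mu> F = measure \<mu> (\<Union>g\<in>S. \<phi> g ` {x \<in> X. \<phi> g x \<in> F})"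
      by simp
    also have "\<dots> \<le> (\<Sum>g\<in>S. measure \<mu> (\<phi> g ` {x \<in> X. \<phi> g x \<in> F}))"
      by (intro measure_UNION_le finite_S sets_image sets) auto
    also have "\<dots> = 0"
      using sets null by (simp add: measure_image)
    finally show False using F(3) by simp
  qed
  then show thesis using that sets by blast
qed

text \<open>
  The points of \<open>C\<close> at which an alternating walk can arrive that starts at an unmatched point and
  uses at most \<open>k\<close> edges of the matching.
\<close>

primrec reach :: "('a \<rightharpoonup> 'g) \<Rightarrow> nat \<Rightarrow> 'a set" where
  "reach \<sigma> 0 = C - dom \<sigma>"
| "reach \<sigma> (Suc k) = reach \<sigma> k \<union> {x \<in> dom \<sigma>. move \<phi> \<sigma> x \<in> nbr (reach \<sigma> k)}"

lemma sets_reach [intro]: "matching \<sigma> \<Longrightarrow> reach \<sigma> k \<in> sets \<mu>"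
  by (induction k) (auto intro!: sets.Diff sets.Un sets_dom sets_move_vimage)

lemma reach_subset: "matching \<sigma> \<Longrightarrow> reach \<sigma> k \<subseteq> C"
  using matchingD(1)[of \<sigma>] by (induction k) auto

text \<open>
  Releasing \<open>V\<close> and sending the unmatched set \<open>W\<close> by one group element into what is free after
  that gives a matching again. It is used with \<open>\<phi> t ` W\<close> equal to the former image of \<open>V\<close>, which
  moves the hole from \<open>W\<close> to \<open>V\<close>, and with \<open>V\<close> empty, which fills the hole \<open>W\<close>.
\<close>

lemma matching_update:
  assumes \<sigma>: "matching \<sigma>" and t: "t \<in> S"
    and W: "W \<in> sets \<mu>" "W \<subseteq> C" "W \<inter> dom \<sigma> = {}"
    and V: "V \<in> sets \<mu>" "V \<subseteq> dom \<sigma>"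
    and im: "\<phi> t ` W \<subseteq> D" "\<phi> t ` W \<inter> move \<phi> \<sigma> ` (dom \<sigma> - V) = {}"
  defines "\<tau> \<equiv> \<lambda>x. if x \<in> V then None else if x \<in> W then Some t else \<sigma> x"
  shows "matching \<tau>" "move \<phi> \<tau> ` dom \<tau> = move \<phi> \<sigma> ` (dom \<sigma> - V) \<union> \<phi> t ` W"
proof -
  have VW: "V \<inter> W = {}" using V W by blast
  have dom: "dom \<tau> = (dom \<sigma> - V) \<union> W"
    using VW by (auto simp: \<tau>_def domIff split: if_splits)
  have mv: "move \<phi> \<tau> x = (if x \<in> W then \<phi> t x else move \<phi> \<sigma> x)" if "x \<in> dom \<tau>" for x
    using that VW by (auto simp: move_def \<tau>_def split: if_splits)
  show range: "move \<phi> \<tau> ` dom \<tau> = move \<phi> \<sigma> ` (dom \<sigma> - V) \<union> \<phi> t ` W"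
  proof -
    have "move \<phi> \<tau> ` dom \<tau> = move \<phi> \<tau> ` (dom \<sigma> - V) \<union> move \<phi> \<tau> ` W"
      unfolding dom by (rule image_Un)
    moreover have "move \<phi> \<tau> ` (dom \<sigma> - V) = move \<phi> \<sigma> ` (dom \<sigma> - V)"
      using W(3) by (intro image_cong) (auto simp: mv dom)
    moreover have "move \<phi> \<tau> ` W = \<phi> t ` W"
      by (intro image_cong) (auto simp: mv dom)
    ultimately show ?thesis by simp
  qed
  have "inj_on (move \<phi> \<tau>) (dom \<tau>)"
  proof (rule inj_onI)
    fix x y assume xy: "x \<in> dom \<tau>" "y \<in> dom \<tau>" "move \<phi> \<tau> x = move \<phi> \<tau> y"
    have sep: "\<phi> t a \<noteq> move \<phi> \<sigma> b" if "a \<in> W" "b \<in> dom \<tau>" "b \<notin> W" for a b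
      using that im(2) unfolding dom by blast
    have "x \<in> W \<longleftrightarrow> y \<in> W"
      using xy sep[of x y] sep[of y x] by (auto simp: mv split: if_splits)
    then show "x = y"
      using xy inj_onD[OF matchingD(4)[OF \<sigma>], of x y] t unfolding mv[OF xy(1)] mv[OF xy(2)]
      by (cases "x \<in> W") (auto simp: dom)
  qed
  moreover have "{x. \<tau> x = Some g} \<in> sets \<mu>" for g
  proof -
    have "{x. \<tau> x = Some g} = ({x. \<sigma> x = Some g} - V) \<union> (if g = t then W else {})"
      using VW W(3) by (auto simp: \<tau>_def)
    then show ?thesis using W V matchingD(3)[OF \<sigma>] by auto
  qed
  moreover have "dom \<tau> \<subseteq> C" using matchingD(1)[OF \<sigma>] W dom by blast
  moreover have "ran \<tau> \<subseteq> S"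
    using matchingD(6)[OF \<sigma>] t by (auto simp: ran_def \<tau>_def split: if_splits)
  moreover have "move \<phi> \<tau> ` dom \<tau> \<subseteq> D"
    unfolding range using matchingD(5)[OF \<sigma>] im by blast
  ultimately show "matching \<tau>" by (simp add: matching_def)
qed

text \<open>
  What later steps need to know about a matching \<open>\<tau>\<close> obtained from \<open>\<sigma>\<close> by exchanging edges along
  alternating walks of at most \<open>k\<close> steps that end in \<open>W\<close>, so that \<open>W\<close> is left unmatched instead of
  the starting points. Keeping the range amounts to keeping the measure of the domain.
\<close>

definition moved_hole :: "('a \<rightharpoonup> 'g) \<Rightarrow> nat \<Rightarrow> 'a set \<Rightarrow> 'a set \<Rightarrow> ('a \<rightharpoonup> 'g) \<Rightarrow> bool" where
  "moved_hole \<sigma> k W E \<tau> \<longleftrightarrow>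
    W \<in> sets \<mu> \<and> 0 < measure \<mu> W \<and> matching \<tau> \<and> W \<inter> dom \<tau> = {} \<and>
    move \<phi> \<tau> ` dom \<tau> = move \<phi> \<sigma> ` dom \<sigma> \<and>
    E \<in> sets \<mu> \<and> W \<subseteq> E \<and> E \<subseteq> reach \<sigma> k \<and> (\<forall>x. x \<notin> E \<longrightarrow> \<tau> x = \<sigma> x) \<and>
    measure \<mu> E \<le> real (Suc k) * measure \<mu> W"

lemma moved_holeD:
  assumes "moved_hole \<sigma> k W E \<tau>"
  shows "W \<in> sets \<mu>" "0 < measure \<mu> W" "matching \<tau>" "W \<inter> dom \<tau> = {}"
    "move \<phi> \<tau> ` dom \<tau> = move \<phi> \<sigma> ` dom \<sigma>"
    "E \<in> sets \<mu>" "W \<subseteq> E" "E \<subseteq> reach \<sigma> k" "x \<notin> E \<Longrightarrow> \<tau> x = \<sigma> x"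
    "measure \<mu> E \<le> real (Suc k) * measure \<mu> W"
  using assms unfolding moved_hole_def by blast+

text \<open>
  A hole can be moved to a part of positive measure of any set that is reachable. In the induction
  step, either part of \<open>V\<close> is reachable in fewer steps, or a piece of the new level of \<open>V\<close> can be
  released in favour of the reachable points one step earlier, after the hole has been moved there.
  That earlier change happened inside \<open>reach \<sigma> k\<close> and does not affect the new level, so no
  conflicts between walks can occur.
\<close>

lemma move_hole:
  assumes \<sigma>: "matching \<sigma>" and "V \<in> sets \<mu>" "V \<subseteq> reach \<sigma> k" "0 < measure \<mu> V"
  shows "\<exists>W\<subseteq>V. \<exists>E \<tau>. moved_hole \<sigma> k W E \<tau>"
  using assms(2-)
proof (induction k arbitrary: V)
  case 0
  then show ?case using \<sigma>
    by (intro exI[of _ V] conjI exI[of _ \<sigma>]) (auto simp: moved_hole_def)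
next
  case (Suc k)
  show ?case
  proof (cases "0 < measure \<mu> (V \<inter> reach \<sigma> k)")
    case True
    obtain W E \<tau> where W: "W \<subseteq> V \<inter> reach \<sigma> k" and m: "moved_hole \<sigma> k W E \<tau>"
      using Suc.IH[OF sets.Int[OF Suc.prems(1) sets_reach[OF \<sigma>]] Int_lower2 True] by blast
    have "measure \<mu> E \<le> real (Suc (Suc k)) * measure \<mu> W"
      using moved_holeD(2,10)[OF m] by (simp add: algebra_simps)
    then have "moved_hole \<sigma> (Suc k) W E \<tau>"
      using m by (auto simp: moved_hole_def)
    then show ?thesis using W by blast
  next
    case False
    \<comment> \<open>The points of \<open>V\<close> that need all \<open>Suc k\<close> steps; they are matched.\<close>
    define V0 where "V0 = V - reach \<sigma> k"
    have sets_V0 [intro]: "V0 \<in> sets \<mu>"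
      using Suc.prems(1) sets_reach[OF \<sigma>] by (auto simp: V0_def)
    have "measure \<mu> V \<le> measure \<mu> V0 + measure \<mu> (V \<inter> reach \<sigma> k)"
      using measure_Un_le[of V0 \<mu> "V \<inter> reach \<sigma> k"] Suc.prems(1) sets_reach[OF \<sigma>, of k] sets_V0
      by (simp add: V0_def Un_Diff_Int)
    then have V0_pos: "0 < measure \<mu> V0"
      using False Suc.prems(3) by linarith
    have V0_dom: "V0 \<subseteq> dom \<sigma>" and V0_nbr: "move \<phi> \<sigma> ` V0 \<subseteq> nbr (reach \<sigma> k)"
      using Suc.prems(2) by (auto simp: V0_def)
    have im_fin: "move \<phi> \<sigma> ` V0 \<in> fmeasurable \<mu>"
      using V0_dom matchingD(5)[OF \<sigma>] by (blast intro: fmeasurable_D sets_move[OF \<sigma>])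
    have im_pos: "0 < measure \<mu> (move \<phi> \<sigma> ` V0)"
      using V0_pos by (simp add: measure_move[OF \<sigma> sets_V0 V0_dom])
    obtain t where t: "t \<in> S" and U: "{x \<in> reach \<sigma> k. \<phi> t x \<in> move \<phi> \<sigma> ` V0} \<in> sets \<mu>"
        "0 < measure \<mu> {x \<in> reach \<sigma> k. \<phi> t x \<in> move \<phi> \<sigma> ` V0}"
      using positive_piece[OF sets_reach[OF \<sigma>] im_fin V0_nbr im_pos] by blast
    obtain W' E \<tau> where W': "W' \<subseteq> {x \<in> reach \<sigma> k. \<phi> t x \<in> move \<phi> \<sigma> ` V0}"
        and "moved_hole \<sigma> k W' E \<tau>"
      using Suc.IH[OF U(1) Collect_restrict U(2)] by blast
    note * = moved_holeD[OF this(2)]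
    have tW': "\<phi> t ` W' \<in> sets \<mu>" using *(1) t by (auto intro: sets_image)
    \<comment> \<open>\<open>W'\<close> takes over the partners of \<open>W\<close>, so the hole moves from \<open>W'\<close> to \<open>W\<close>.\<close>
    define W where "W = {x \<in> V0. move \<phi> \<sigma> x \<in> \<phi> t ` W'}"
    have W_sets: "W \<in> sets \<mu>"
    proof -
      have "W = V0 \<inter> {x \<in> dom \<sigma>. move \<phi> \<sigma> x \<in> \<phi> t ` W'}"
        using V0_dom by (auto simp: W_def)
      then show ?thesis using sets_V0 sets_move_vimage[OF \<sigma> tW'] by auto
    qed
    have WE: "W \<inter> E = {}" using *(8) by (auto simp: W_def V0_def)
    then have \<tau>W: "\<tau> x = \<sigma> x" if "x \<in> W" for x
      using *(9) that by blast
    have W_dom: "W \<subseteq> dom \<sigma>" "W \<subseteq> dom \<tau>"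
      using V0_dom \<tau>W by (auto simp: W_def domIff)
    have "\<phi> t ` W' \<subseteq> move \<phi> \<sigma> ` V0" using W' by blast
    have im_\<sigma>: "move \<phi> \<sigma> ` W = \<phi> t ` W'"
    proof (intro equalityI subsetI)
      fix y assume y: "y \<in> \<phi> t ` W'"
      then obtain x where "x \<in> V0" "y = move \<phi> \<sigma> x"
        using \<open>\<phi> t ` W' \<subseteq> move \<phi> \<sigma> ` V0\<close> by blast
      then show "y \<in> move \<phi> \<sigma> ` W" using y by (simp add: W_def)
    next
      fix y assume "y \<in> move \<phi> \<sigma> ` W"
      then show "y \<in> \<phi> t ` W'" unfolding W_def by (elim imageE CollectE) simp
    qed
    have im_\<tau>: "move \<phi> \<tau> ` W = \<phi> t ` W'"
      unfolding im_\<sigma>[symmetric] using \<tau>W by (intro image_cong) (auto intro: move_cong)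
    have m_eq: "measure \<mu> W = measure \<mu> W'"
      using measure_move[OF \<sigma> W_sets W_dom(1)] measure_image[OF _ *(1)] t by (simp add: im_\<sigma>)
    define \<rho> where "\<rho> = (\<lambda>x. if x \<in> W then None else if x \<in> W' then Some t else \<tau> x)"
    have "\<phi> t ` W' \<subseteq> D"
      using matchingD(5)[OF \<sigma>] W_dom unfolding im_\<sigma>[symmetric] by blast
    moreover have "\<phi> t ` W' \<inter> move \<phi> \<tau> ` (dom \<tau> - W) = {}"
      unfolding im_\<tau>[symmetric]
      using inj_onD[OF matchingD(4)[OF *(3)]] W_dom(2) by blast
    moreover have "W' \<subseteq> C"
      using W' reach_subset[OF \<sigma>] by blast
    ultimately have \<rho>: "matching \<rho>" "move \<phi> \<rho> ` dom \<rho> = move \<phi> \<tau> ` (dom \<tau> - W) \<union> \<phi> t ` W'"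
      using matching_update[OF *(3) t *(1) _ *(4) W_sets W_dom(2)] unfolding \<rho>_def by blast+
    have "move \<phi> \<rho> ` dom \<rho> = move \<phi> \<sigma> ` dom \<sigma>"
      unfolding \<rho>(2) im_\<tau>[symmetric] *(5)[symmetric] using W_dom by blast
    moreover have "measure \<mu> (E \<union> W) \<le> real (Suc (Suc k)) * measure \<mu> W"
    proof -
      have "measure \<mu> (E \<union> W) \<le> measure \<mu> E + measure \<mu> W"
        using *(6) W_sets by (rule measure_Un_le)
      also have "\<dots> \<le> real (Suc (Suc k)) * measure \<mu> W"
        using *(10) by (simp add: m_eq algebra_simps)
      finally show ?thesis .
    qed
    moreover have "W \<inter> dom \<rho> = {}" by (auto simp: \<rho>_def domIff)
    moreover have "W \<subseteq> V" by (auto simp: W_def V0_def)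
    moreover have "0 < measure \<mu> W" using m_eq *(2) by simp
    moreover have "E \<union> W \<subseteq> reach \<sigma> (Suc k)"
      using *(8) Suc.prems(2) \<open>W \<subseteq> V\<close> unfolding reach.simps by blast
    moreover have "\<forall>x. x \<notin> E \<union> W \<longrightarrow> \<rho> x = \<sigma> x"
      using *(7,9) by (auto simp: \<rho>_def)
    ultimately have "moved_hole \<sigma> (Suc k) W (E \<union> W) \<rho>"
      unfolding moved_hole_def using \<rho>(1) W_sets *(6) by blast
    then show ?thesis using \<open>W \<subseteq> V\<close> by blast
  qed
qed

text \<open>
  Once a hole is at a set that can be sent to unmatched points of \<open>D\<close>, filling it improves the
  matching by its measure. The price is at most \<open>Suc k\<close> times that gain.
\<close>

lemma augment:
  assumes \<sigma>: "matching \<sigma>"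
    and pos: "0 < measure \<mu> (nbr (reach \<sigma> k) \<inter> (D - move \<phi> \<sigma> ` dom \<sigma>))"
  obtains \<tau> where "matching \<tau>" "deficiency \<tau> < deficiency \<sigma>"
    "measure \<mu> {x. \<sigma> x \<noteq> \<tau> x} \<le> real (Suc k) * (deficiency \<sigma> - deficiency \<tau>)"
proof -
  let ?H = "D - move \<phi> \<sigma> ` dom \<sigma>"
  let ?F = "nbr (reach \<sigma> k) \<inter> ?H"
  have sets_r: "reach \<sigma> k \<in> sets \<mu>" using \<sigma> by auto
  have "?F \<in> sets \<mu>"
    using sets_r sets_move[OF \<sigma> sets_dom[OF \<sigma>]] by auto
  then have "?F \<in> fmeasurable \<mu>" by (rule fmeasurable_D) auto
  from positive_piece[OF sets_r this _ pos] obtain t where t: "t \<in> S"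
    and V: "{x \<in> reach \<sigma> k. \<phi> t x \<in> ?F} \<in> sets \<mu>" "0 < measure \<mu> {x \<in> reach \<sigma> k. \<phi> t x \<in> ?F}"
    by blast
  obtain W E \<tau> where W: "W \<subseteq> {x \<in> reach \<sigma> k. \<phi> t x \<in> ?F}" and "moved_hole \<sigma> k W E \<tau>"
    using move_hole[OF \<sigma> V(1) Collect_restrict V(2)] by blast
  note * = moved_holeD[OF this(2)]
  define \<rho> where "\<rho> = (\<lambda>x. if x \<in> {} then None else if x \<in> W then Some t else \<tau> x)"
  have "W \<subseteq> C" using W reach_subset[OF \<sigma>] by blast
  moreover have tW: "\<phi> t ` W \<subseteq> ?H" using W by auto
  moreover from tW have "\<phi> t ` W \<subseteq> D" by blast
  moreover have "\<phi> t ` W \<inter> move \<phi> \<tau> ` (dom \<tau> - {}) = {}"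
    using tW *(5) by auto
  ultimately have "matching \<rho>" "move \<phi> \<rho> ` dom \<rho> = move \<phi> \<tau> ` (dom \<tau> - {}) \<union> \<phi> t ` W"
    using matching_update[OF *(3) t *(1) _ *(4), of "{}"] unfolding \<rho>_def by blast+
  then have \<rho>: "matching \<rho>" "move \<phi> \<rho> ` dom \<rho> = move \<phi> \<sigma> ` dom \<sigma> \<union> \<phi> t ` W"
    by (simp_all add: *(5))
  have "measure \<mu> (move \<phi> \<sigma> ` dom \<sigma> \<union> \<phi> t ` W)
      = measure \<mu> (move \<phi> \<sigma> ` dom \<sigma>) + measure \<mu> (\<phi> t ` W)"
  proof (rule measure_Union)
    have s: "\<phi> t ` W \<in> sets \<mu>" "move \<phi> \<sigma> ` dom \<sigma> \<in> sets \<mu>"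
      using sets_image[OF S_act[OF t] *(1)] sets_move[OF \<sigma> sets_dom[OF \<sigma>]] by auto
    then show "\<phi> t ` W \<in> sets \<mu>" "move \<phi> \<sigma> ` dom \<sigma> \<in> sets \<mu>" by auto
    have "\<phi> t ` W \<in> fmeasurable \<mu>" "move \<phi> \<sigma> ` dom \<sigma> \<in> fmeasurable \<mu>"
      using s tW matchingD(5)[OF \<sigma>] by (auto intro!: fmeasurable_D)
    then show "emeasure \<mu> (move \<phi> \<sigma> ` dom \<sigma>) \<noteq> \<infinity>" "emeasure \<mu> (\<phi> t ` W) \<noteq> \<infinity>"
      by (auto dest: fmeasurableD2)
  qed (use tW in auto)
  then have gain: "deficiency \<sigma> - deficiency \<rho> = measure \<mu> W"
    using t by (simp add: deficiency_range \<sigma> \<rho> measure_image[OF _ *(1)])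
  have "measure \<mu> {x. \<sigma> x \<noteq> \<rho> x} \<le> measure \<mu> E"
  proof (rule measure_mono_fmeasurable)
    have "\<rho> x = \<sigma> x" if "x \<notin> E" for x
      using *(7) *(9)[OF that] that by (auto simp: \<rho>_def)
    then show "{x. \<sigma> x \<noteq> \<rho> x} \<subseteq> E" by force
    show "{x. \<sigma> x \<noteq> \<rho> x} \<in> sets \<mu>" using sets_differ \<sigma> \<rho> by blast
    show "E \<in> fmeasurable \<mu>"
      using *(6,8) reach_subset[OF \<sigma>] by (blast intro: fmeasurable_C)
  qed
  then show thesis
    using gain *(2,10) \<rho>(1) by (intro that[of \<rho>]) auto
qed

end

section \<open>Limits of matchings\<close>

context bipartite_action_graph
begin

lemma measure_differ_triangle:
  assumes "matching \<sigma>" "matching \<tau>" "matching \<rho>"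
  shows "measure \<mu> {x. \<sigma> x \<noteq> \<rho> x} \<le> measure \<mu> {x. \<sigma> x \<noteq> \<tau> x} + measure \<mu> {x. \<tau> x \<noteq> \<rho> x}"
proof -
  have "measure \<mu> {x. \<sigma> x \<noteq> \<rho> x} \<le> measure \<mu> ({x. \<sigma> x \<noteq> \<tau> x} \<union> {x. \<tau> x \<noteq> \<rho> x})"
    using assms sets_differ differ_subset
    by (intro measure_mono_fmeasurable fmeasurable_C sets.Un) auto
  also have "\<dots> \<le> measure \<mu> {x. \<sigma> x \<noteq> \<tau> x} + measure \<mu> {x. \<tau> x \<noteq> \<rho> x}"
    using assms by (intro measure_Un_le sets_differ)
  finally show ?thesis .
qed

lemma deficiency_le_differ:
  assumes "matching \<sigma>" "matching \<tau>"
  shows "deficiency \<tau> \<le> deficiency \<sigma> + measure \<mu> {x. \<sigma> x \<noteq> \<tau> x}"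
proof -
  have "measure \<mu> (C - dom \<tau>) \<le> measure \<mu> ((C - dom \<sigma>) \<union> {x. \<sigma> x \<noteq> \<tau> x})"
    using assms sets_differ[OF assms] differ_subset[OF assms] sets_dom
    by (intro measure_mono_fmeasurable fmeasurable_C sets.Un sets.Diff) auto
  also have "\<dots> \<le> measure \<mu> (C - dom \<sigma>) + measure \<mu> {x. \<sigma> x \<noteq> \<tau> x}"
    using assms sets_dom by (intro measure_Un_le sets_differ sets.Diff) auto
  finally show ?thesis by (simp add: deficiency_def)
qed

text \<open>
  The preorder to which the ordering principle is applied: passing from \<open>\<sigma>\<close> to \<open>\<tau>\<close> is paid for by
  the decrease of \<open>sqrt\<close> of the deficiency. Payments add up along a chain, which makes the total
  change finite.
\<close>

definition cheaper :: "real \<Rightarrow> ('a \<rightharpoonup> 'g) \<Rightarrow> ('a \<rightharpoonup> 'g) \<Rightarrow> bool" where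
  "cheaper c \<sigma> \<tau> \<longleftrightarrow>
    measure \<mu> {x. \<sigma> x \<noteq> \<tau> x} \<le> c * (sqrt (deficiency \<sigma>) - sqrt (deficiency \<tau>))"

lemma cheaper_trans:
  assumes "matching \<sigma>" "matching \<tau>" "matching \<rho>" "cheaper c \<sigma> \<tau>" "cheaper c \<tau> \<rho>"
  shows "cheaper c \<sigma> \<rho>"
  using measure_differ_triangle[OF assms(1-3)] assms(4,5) by (simp add: cheaper_def algebra_simps)

lemma cheaper_deficiency:
  assumes "0 < c" "cheaper c \<sigma> \<tau>"
  shows "deficiency \<tau> \<le> deficiency \<sigma>"
proof -
  have "0 \<le> c * (sqrt (deficiency \<sigma>) - sqrt (deficiency \<tau>))"
    using assms(2) measure_nonneg[of \<mu>] unfolding cheaper_def by (rule order_trans[rotated])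
  then show ?thesis using assms(1) by (simp add: zero_le_mult_iff)
qed

text \<open>
  The pointwise limit of a sequence of partial maps to a discrete set; points where the sequence
  does not stabilize are left unmatched.
\<close>

definition eventual_value :: "(nat \<Rightarrow> 'a \<rightharpoonup> 'g) \<Rightarrow> 'a \<rightharpoonup> 'g" where
  "eventual_value s x =
    (if \<exists>v. \<forall>\<^sub>F n in sequentially. s n x = v
     then THE v. \<forall>\<^sub>F n in sequentially. s n x = v else None)"

lemma eventual_value_eq:
  assumes "\<forall>\<^sub>F n in sequentially. s n x = v"
  shows "eventual_value s x = v"
proof -
  have unique: "w = v" if "\<forall>\<^sub>F n in sequentially. s n x = w" for w
  proof -
    have "\<forall>\<^sub>F n in sequentially. w = v"
      using assms that by eventually_elim simp
    then show ?thesis by simp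
  qed
  have the: "(THE v. \<forall>\<^sub>F n in sequentially. s n x = v) = v"
    by (rule the_equality) (use assms unique in blast)+
  have ex: "\<exists>v. \<forall>\<^sub>F n in sequentially. s n x = v"
    using assms by (rule exI)
  show ?thesis
    unfolding eventual_value_def if_P[OF ex] by (rule the)
qed

lemma eventual_value_Some_iff:
  "eventual_value s x = Some g \<longleftrightarrow> (\<forall>\<^sub>F n in sequentially. s n x = Some g)"
proof
  assume *: "eventual_value s x = Some g"
  then obtain v where "\<forall>\<^sub>F n in sequentially. s n x = v"
    unfolding eventual_value_def by (metis option.distinct(1))
  with eventual_value_eq[of s x v] * show "\<forall>\<^sub>F n in sequentially. s n x = Some g" by simp
qed (rule eventual_value_eq)

text \<open>
  Apart from measurability, every condition on a matching concerns at most two points at a time, and at two points the limit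
  agrees with some member of the sequence.
\<close>

lemma matching_eventual_value:
  assumes s: "\<And>n. matching (s n)"
  shows "matching (eventual_value s)"
proof -
  let ?l = "eventual_value s"
  have ex: "\<exists>n. s n x = ?l x \<and> s n y = ?l y" if xy: "x \<in> dom ?l" "y \<in> dom ?l" for x y
  proof -
    obtain g h where gh: "?l x = Some g" "?l y = Some h" using xy by (auto simp: dom_def)
    then have "\<forall>\<^sub>F n in sequentially. s n x = Some g \<and> s n y = Some h"
      by (simp add: eventual_value_Some_iff eventually_conj)
    then obtain n where "s n x = Some g \<and> s n y = Some h"
      using eventually_happens'[OF sequentially_bot] by blast
    then show ?thesis using gh by metis
  qed
  have one: "\<exists>n. s n x = ?l x \<and> x \<in> dom (s n)" if "x \<in> dom ?l" for x
    using ex[OF that that] that by (metis domIff)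
  have "inj_on (move \<phi> ?l) (dom ?l)"
  proof (rule inj_onI)
    fix x y assume xy: "x \<in> dom ?l" "y \<in> dom ?l" "move \<phi> ?l x = move \<phi> ?l y"
    obtain n where n: "s n x = ?l x" "s n y = ?l y" using ex xy by blast
    then have "move \<phi> (s n) x = move \<phi> (s n) y" using xy(3) by (simp add: move_def)
    moreover have "x \<in> dom (s n)" "y \<in> dom (s n)" using n xy by (auto simp: domIff)
    ultimately show "x = y" using inj_onD[OF matchingD(4)[OF s]] by blast
  qed
  moreover have "{x. ?l x = Some g} \<in> sets \<mu>" for g
  proof -
    have "{x. ?l x = Some g} = (\<Union>N. \<Inter>n\<in>{N..}. {x. s n x = Some g})"
      by (auto simp: eventual_value_Some_iff eventually_sequentially)
    also have "\<dots> \<in> sets \<mu>"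
      by (intro sets.countable_UN image_subsetI sets.countable_INT'' matchingD(3)[OF s])
        (use sets.top[of \<mu>] in \<open>auto simp: space_UNIV\<close>)
    finally show ?thesis .
  qed
  moreover have "dom ?l \<subseteq> C"
    using one matchingD(1)[OF s] by blast
  moreover have "ran ?l \<subseteq> S"
  proof
    fix g assume "g \<in> ran ?l"
    then obtain x where "?l x = Some g" by (auto simp: ran_def)
    then obtain n where "s n x = Some g" using one[of x] by auto
    then show "g \<in> S" by (rule matchingD(6)[OF s])
  qed
  moreover have "move \<phi> ?l ` dom ?l \<subseteq> D"
  proof (rule image_subsetI)
    fix x assume "x \<in> dom ?l"
    then obtain n where "s n x = ?l x" "x \<in> dom (s n)" using one by blast
    then show "move \<phi> ?l x \<in> D"
      using matchingD(5)[OF s, of n] move_cong[of "s n" x ?l \<phi>] by (metis image_subset_iff)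
  qed
  ultimately show ?thesis by (simp add: matching_def)
qed

text \<open>
  The limit differs from \<open>s n\<close> only where some later step changes the value, and the measures of
  these changes telescope. As the deficiency depends continuously on the matching, the limit
  pays no more than is left of the decrease along the sequence.
\<close>

lemma cheaper_eventual_value:
  assumes s: "\<And>n. matching (s n)" and c: "0 < c" and ch: "\<And>n. cheaper c (s n) (s (Suc n))"
  shows "cheaper c (s n) (eventual_value s)"
proof -
  let ?l = "eventual_value s"
  define f where "f n = sqrt (deficiency (s n))" for n
  have l: "matching ?l" using s by (rule matching_eventual_value)
  have f_nonneg: "0 \<le> f n" for n by (simp add: f_def deficiency_nonneg)
  have dec: "decseq f"
    unfolding decseq_Suc_iff f_def using cheaper_deficiency[OF c ch] by simp
  obtain L where L: "f \<longlonglongrightarrow> L" "\<forall>n. L \<le> f n"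
    using decseq_convergent[OF dec] f_nonneg by blast
  have bound: "measure \<mu> {x. s n x \<noteq> ?l x} \<le> c * (f n - L)" for n
  proof -
    define E where "E m = {x. s (n + m) x \<noteq> s (n + Suc m) x}" for m
    have E: "E m \<in> sets \<mu>" "E m \<subseteq> C" for m
      unfolding E_def using sets_differ differ_subset s by blast+
    have "measure \<mu> (\<Union>m\<le>k. E m) \<le> c * (f n - L)" for k
    proof -
      have "measure \<mu> (\<Union>m\<le>k. E m) \<le> (\<Sum>m\<le>k. measure \<mu> (E m))"
        using E by (intro measure_UNION_le) auto
      also have "\<dots> \<le> (\<Sum>m\<le>k. c * (f (n + m) - f (n + Suc m)))"
        using ch unfolding cheaper_def E_def f_def by (intro sum_mono) auto
      also have "\<dots> = c * (f n - f (n + Suc k))"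
        by (induction k) (auto simp: algebra_simps)
      also have "\<dots> \<le> c * (f n - L)"
        using c L(2) by (intro mult_left_mono) auto
      finally show ?thesis .
    qed
    then have le: "measure \<mu> (\<Union>m. E m) \<le> c * (f n - L)"
      using E by (intro measure_countable_Union_le fmeasurable_C) auto
    have "{x. s n x \<noteq> ?l x} \<subseteq> (\<Union>m. E m)"
    proof (rule subsetI, rule ccontr)
      fix x assume x: "x \<in> {x. s n x \<noteq> ?l x}" "x \<notin> (\<Union>m. E m)"
      have "s (n + m) x = s n x" for m
        using x(2) by (induction m) (auto simp: E_def)
      then have "\<forall>\<^sub>F k in sequentially. s k x = s n x"
        unfolding eventually_sequentially by (metis le_Suc_ex)
      then have "?l x = s n x" by (rule eventual_value_eq)
      then show False using x(1) by simp
    qed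
    moreover have "(\<Union>m. E m) \<in> fmeasurable \<mu>"
      using E by (intro fmeasurable_C) auto
    ultimately have "measure \<mu> {x. s n x \<noteq> ?l x} \<le> measure \<mu> (\<Union>m. E m)"
      using sets_differ[OF s l] by (intro measure_mono_fmeasurable) auto
    with le show ?thesis by linarith
  qed
  have "sqrt (deficiency ?l) \<le> L"
  proof -
    have "(\<lambda>n. (f n)\<^sup>2 + c * (f n - L)) \<longlonglongrightarrow> L\<^sup>2 + c * (L - L)"
      by (intro tendsto_intros L(1))
    moreover have "deficiency ?l \<le> (f n)\<^sup>2 + c * (f n - L)" for n
      using deficiency_le_differ[OF s l, of n] bound[of n] by (simp add: f_def deficiency_nonneg)
    ultimately have "deficiency ?l \<le> L\<^sup>2 + c * (L - L)"
      by (intro LIMSEQ_le_const) auto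
    moreover have "0 \<le> L"
      using L(1) f_nonneg by (intro LIMSEQ_le_const) auto
    ultimately show ?thesis by (intro real_le_lsqrt) (auto simp: deficiency_nonneg)
  qed
  then have "c * (f n - L) \<le> c * (f n - sqrt (deficiency ?l))"
    using c by (intro mult_left_mono) auto
  then show ?thesis
    using bound[of n] unfolding cheaper_def f_def by linarith
qed

end

section \<open>Perfect matchings in expanding graphs\<close>

text \<open>
  Small sets at least double. The threshold \<open>2/3\<close> serves both phases of the search for augmenting
  walks: the set reached grows up to it, and its complement is then at most \<open>1/3\<close>, well below it.
\<close>

locale expanding_action_graph = bipartite_action_graph +
  assumes nbr_C: "X \<in> sets \<mu> \<Longrightarrow> X \<subseteq> C \<Longrightarrow>
      min (2/3 * measure \<mu> C) (2 * measure \<mu> X) \<le> measure \<mu> (nbr X \<inter> D)"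
    and nbr_D: "Y \<in> sets \<mu> \<Longrightarrow> Y \<subseteq> D \<Longrightarrow>
      min (2/3 * measure \<mu> C) (2 * measure \<mu> Y) \<le> measure \<mu> (nbr Y \<inter> C)"
begin

text \<open>
  Suppose that almost no walk with at most \<open>2 * j\<close> steps ends in an unmatched point of \<open>D\<close>. Then
  almost every neighbour of a reachable set is matched, so the next reachable set is at least as large as the
  neighbourhood. Expansion from \<open>C\<close> to \<open>D\<close> makes the reachable sets grow to \<open>2/3\<close> of \<open>C\<close> within \<open>j\<close>
  steps. From then on, expansion from \<open>D\<close> to \<open>C\<close>, applied to the points not adjacent to the
  reachable set, halves the complement in each step. But the unmatched points of \<open>D\<close> are among
  these points, so the complement keeps at least twice their measure, which is too much after
  \<open>2 * j\<close> steps.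
\<close>

lemma reach_unmatched:
  assumes \<sigma>: "matching \<sigma>" and u: "0 < deficiency \<sigma>" and j: "measure \<mu> C \<le> 2 ^ j * deficiency \<sigma>"
  obtains k where "k \<le> 2 * j" "0 < measure \<mu> (nbr (reach \<sigma> k) \<inter> (D - move \<phi> \<sigma> ` dom \<sigma>))"
proof -
  define m where "m = measure \<mu> C"
  define u where "u = deficiency \<sigma>"
  define R where "R = move \<phi> \<sigma> ` dom \<sigma>"
  have R: "R \<in> sets \<mu>" "R \<subseteq> D"
    unfolding R_def using sets_move[OF \<sigma> sets_dom[OF \<sigma>]] matchingD(5)[OF \<sigma>] by auto
  have r: "reach \<sigma> k \<in> sets \<mu>" "reach \<sigma> k \<subseteq> C" for k
    using sets_reach[OF \<sigma>] reach_subset[OF \<sigma>] by auto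
  have u_pos: "0 < u" using assms by (simp add: u_def)
  have "u \<le> m"
    unfolding u_def m_def using deficiency_range[OF \<sigma>] measure_nonneg[of \<mu>] by simp
  then have m_pos: "0 < m" using u_pos by simp
  have "\<exists>k\<le>2 * j. 0 < measure \<mu> (nbr (reach \<sigma> k) \<inter> (D - R))"
  proof (rule ccontr)
    assume "\<not> ?thesis"
    then have null: "measure \<mu> (nbr (reach \<sigma> k) \<inter> (D - R)) = 0" if "k \<le> 2 * j" for k
      using that by (metis measure_nonneg less_eq_real_def)
    have step: "measure \<mu> (nbr (reach \<sigma> k) \<inter> D) \<le> measure \<mu> (reach \<sigma> (Suc k))" if "k \<le> 2 * j" for k
    proof -
      let ?N = "nbr (reach \<sigma> k)"
      let ?V = "{x \<in> dom \<sigma>. move \<phi> \<sigma> x \<in> ?N}"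
      have N: "?N \<in> sets \<mu>" using r by auto
      have V: "?V \<in> sets \<mu>" using sets_move_vimage[OF \<sigma> N] .
      have "?N \<inter> D = (?N \<inter> R) \<union> (?N \<inter> (D - R))" using R by blast
      then have "measure \<mu> (?N \<inter> D) \<le> measure \<mu> (?N \<inter> R) + measure \<mu> (?N \<inter> (D - R))"
        using N R by (metis measure_Un_le sets.Diff sets.Int sets_D)
      also have "\<dots> = measure \<mu> (?N \<inter> R)" using null[OF that] by simp
      also have "?N \<inter> R = move \<phi> \<sigma> ` ?V" by (auto simp: R_def)
      also have "measure \<mu> (move \<phi> \<sigma> ` ?V) = measure \<mu> ?V"
        using measure_move[OF \<sigma> V] by blast
      also have "\<dots> \<le> measure \<mu> (reach \<sigma> (Suc k))"
        using V r[of "Suc k"] by (intro measure_mono_fmeasurable fmeasurable_C) auto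
      finally show ?thesis .
    qed
    have growing: "min (2/3 * m) (2 ^ k * u) \<le> measure \<mu> (reach \<sigma> k)" if "k \<le> 2 * j" for k
      using that
    proof (induction k)
      case 0
      show ?case by (simp add: u_def deficiency_def)
    next
      case (Suc k)
      have "min (2/3 * m) (2 * measure \<mu> (reach \<sigma> k)) \<le> measure \<mu> (reach \<sigma> (Suc k))"
        using nbr_C[OF r, of k] step[of k] Suc.prems by (simp add: m_def)
      moreover have "min (2/3 * m) (2 ^ k * u) \<le> measure \<mu> (reach \<sigma> k)"
        using Suc by simp
      moreover have "min q (2 * x) \<le> b" if "min q (2 * a) \<le> b" "min q x \<le> a" "0 \<le> q"
        for q x a b :: real
        using that by (auto simp: min_def split: if_splits)
      ultimately have "min (2/3 * m) (2 * (2 ^ k * u)) \<le> measure \<mu> (reach \<sigma> (Suc k))"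
        using m_pos by (metis divide_nonneg_pos mult_nonneg_nonneg less_imp_le zero_le_numeral zero_less_numeral)
      then show ?case by (simp only: power_Suc mult.assoc)
    qed
    have shrinking: "2 * measure \<mu> (D - nbr (reach \<sigma> k)) \<le> measure \<mu> (C - reach \<sigma> k)"
      if "measure \<mu> (C - reach \<sigma> k) \<le> m / 3" for k
    proof -
      let ?Y = "D - nbr (reach \<sigma> k)"
      have Y: "?Y \<in> sets \<mu>" using r by auto
      have "min (2/3 * m) (2 * measure \<mu> ?Y) \<le> measure \<mu> (nbr ?Y \<inter> C)"
        unfolding m_def using Y by (intro nbr_D) auto
      also have "\<dots> \<le> measure \<mu> (C - reach \<sigma> k)"
      proof (rule measure_mono_fmeasurable)
        show "nbr ?Y \<inter> C \<subseteq> C - reach \<sigma> k"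
          by (auto simp: mem_nbr[of _ "D - nbr (reach \<sigma> k)"] intro: nbr_memI)
      qed (use Y r in \<open>auto intro!: fmeasurable_C\<close>)
      finally show ?thesis using that m_pos by (auto simp: min_def split: if_splits)
    qed
    have small: "measure \<mu> (C - reach \<sigma> (j + i)) \<le> m / 3 / 2 ^ i" if "i \<le> j" for i
      using that
    proof (induction i)
      case 0
      have "2/3 * m \<le> measure \<mu> (reach \<sigma> j)"
        using growing[of j] j m_pos by (simp add: u_def m_def min_def split: if_splits)
      then show ?case using measure_Diff_C[OF r] by (simp add: m_def)
    next
      case (Suc i)
      let ?k = "j + i"
      have IH: "measure \<mu> (C - reach \<sigma> ?k) \<le> m / 3 / 2 ^ i" using Suc by simp
      also have "m / 3 / 2 ^ i \<le> m / 3 / 1"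
        using m_pos by (intro divide_left_mono) auto
      finally have "2 * measure \<mu> (D - nbr (reach \<sigma> ?k)) \<le> measure \<mu> (C - reach \<sigma> ?k)"
        using shrinking by simp
      moreover have "measure \<mu> (C - reach \<sigma> (Suc ?k)) \<le> measure \<mu> (D - nbr (reach \<sigma> ?k))"
      proof -
        have "measure \<mu> (D - nbr (reach \<sigma> ?k)) = measure \<mu> (D - nbr (reach \<sigma> ?k) \<inter> D)"
          by (rule arg_cong[where f = "measure \<mu>"]) blast
        also have "\<dots> = m - measure \<mu> (nbr (reach \<sigma> ?k) \<inter> D)"
          unfolding m_def using r by (intro measure_Diff_D) auto
        finally show ?thesis
          using step[of ?k] Suc.prems measure_Diff_C[OF r, of "Suc ?k"] by (simp add: m_def)
      qed
      moreover have "x \<le> q / 2" if "2 * y \<le> z" "x \<le> y" "z \<le> q" for x y z q :: real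
        using that by linarith
      ultimately have "measure \<mu> (C - reach \<sigma> (Suc ?k)) \<le> m / 3 / 2 ^ i / 2"
        using IH by blast
      then show ?case by (simp add: field_simps del: reach.simps)
    qed
    have "u \<le> measure \<mu> (D - nbr (reach \<sigma> (2 * j)))"
    proof -
      let ?N = "nbr (reach \<sigma> (2 * j))"
      have N: "?N \<in> sets \<mu>" using r by auto
      have "u = measure \<mu> (D - R)"
        unfolding u_def deficiency_range[OF \<sigma>] using measure_Diff_D[OF R] by (simp add: R_def)
      also have "\<dots> \<le> measure \<mu> ((?N \<inter> (D - R)) \<union> (D - ?N))"
        using N R by (intro measure_mono_fmeasurable fmeasurable_D) auto
      also have "\<dots> \<le> measure \<mu> (?N \<inter> (D - R)) + measure \<mu> (D - ?N)"
        using N R by (intro measure_Un_le) auto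
      finally show ?thesis using null[of "2 * j"] by simp
    qed
    moreover have "measure \<mu> (C - reach \<sigma> (2 * j)) \<le> m / 3 / 2 ^ j"
      using small[of j] by (simp add: mult_2)
    moreover have "m / 3 / 2 ^ j \<le> m / 3 / 1"
      using m_pos by (intro divide_left_mono) auto
    ultimately have "2 * u \<le> m / 3 / 2 ^ j"
      using shrinking[of "2 * j"] by simp
    then have "2 * (2 ^ j * u) \<le> m / 3" by (simp add: field_simps)
    then show False using j m_pos unfolding m_def u_def by linarith
  qed
  then show thesis using that unfolding R_def by blast
qed

text \<open>
  The bound that replaces the logarithmic length of the walks by the inverse of a square root.
\<close>

lemma odd_square_le_power: "(2 * j + 1)\<^sup>2 \<le> 16 * (2::nat) ^ j"
proof -
  have *: "(2 * (j + 2) + 1)\<^sup>2 \<le> 16 * (2::nat) ^ (j + 2)" for j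
    by (induction j) (auto simp: power2_eq_square algebra_simps)
  show ?thesis
  proof (cases "j < 2")
    case True
    then have "j = 0 \<or> j = 1" by auto
    then show ?thesis by auto
  next
    case False
    then obtain i where "j = i + 2" by (metis add.commute le_Suc_ex not_less)
    then show ?thesis using *[of i] by simp
  qed
qed

text \<open>
  Walks of length at most \<open>2 * j + 1\<close> suffice, where \<open>2 ^ j\<close> is about \<open>measure \<mu> C / u\<close>, so the
  length is at most \<open>sqrt (32 * measure \<mu> C / u)\<close>. With \<open>u - v = (sqrt u + sqrt v) * (sqrt u - sqrt v)\<close>
  and \<open>v \<le> u\<close>, the cost of the gain \<open>u - v\<close> is at most \<open>2 * sqrt (32 * measure \<mu> C)\<close> times the decrease of
  the square root.
\<close>

lemma improve:
  assumes \<sigma>: "matching \<sigma>" and u: "0 < deficiency \<sigma>"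
  obtains \<tau> where "matching \<tau>" "deficiency \<tau> < deficiency \<sigma>"
    "cheaper (sqrt (128 * measure \<mu> C)) \<sigma> \<tau>"
proof -
  define m where "m = measure \<mu> C"
  define u where "u = deficiency \<sigma>"
  have u_pos: "0 < u" using assms by (simp add: u_def)
  have um: "u \<le> m"
    unfolding u_def m_def using deficiency_range[OF \<sigma>] measure_nonneg[of \<mu>] by simp
  define j where "j = (LEAST j. m \<le> 2 ^ j * u)"
  have ex: "\<exists>j. m \<le> 2 ^ j * u"
  proof -
    obtain j where "m / u < 2 ^ j" using real_arch_pow[of 2 "m / u"] by auto
    then show ?thesis using u_pos by (intro exI[of _ j]) (simp add: field_simps)
  qed
  have j: "m \<le> 2 ^ j * u" unfolding j_def using ex by (rule LeastI_ex)
  have j_min: "2 ^ j * u \<le> 2 * m"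
  proof (cases j)
    case 0
    then show ?thesis using um u_pos by simp
  next
    case (Suc i)
    then have "\<not> m \<le> 2 ^ i * u" using not_less_Least[of i "\<lambda>j. m \<le> 2 ^ j * u"] by (simp add: j_def)
    then show ?thesis using Suc by simp
  qed
  obtain k where k: "k \<le> 2 * j" "0 < measure \<mu> (nbr (reach \<sigma> k) \<inter> (D - move \<phi> \<sigma> ` dom \<sigma>))"
    using reach_unmatched[OF \<sigma> u] j unfolding m_def u_def by blast
  obtain \<tau> where \<tau>: "matching \<tau>" "deficiency \<tau> < deficiency \<sigma>"
      "measure \<mu> {x. \<sigma> x \<noteq> \<tau> x} \<le> real (Suc k) * (deficiency \<sigma> - deficiency \<tau>)"
    using augment[OF \<sigma> k(2)] by blast
  define v where "v = deficiency \<tau>"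
  have v: "0 \<le> v" "v < u" using \<tau>(2) by (auto simp: v_def u_def deficiency_nonneg)
  have "real (Suc k) * sqrt u \<le> sqrt (32 * m)"
  proof (rule real_le_rsqrt)
    have "(real (Suc k))\<^sup>2 \<le> (real (2 * j + 1))\<^sup>2"
      using k(1) by (intro power_mono) auto
    also have "\<dots> = real ((2 * j + 1)\<^sup>2)" by simp
    also have "\<dots> \<le> real (16 * 2 ^ j)" using odd_square_le_power by (rule of_nat_mono)
    finally have "(real (Suc k))\<^sup>2 * u \<le> real (16 * 2 ^ j) * u"
      using u_pos by (intro mult_right_mono) auto
    also have "\<dots> = 16 * (2 ^ j * u)" by simp
    also have "\<dots> \<le> 32 * m" using j_min by linarith
    finally show "(real (Suc k) * sqrt u)\<^sup>2 \<le> 32 * m"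
      using u_pos by (simp add: power_mult_distrib)
  qed
  then have key: "real (Suc k) * (sqrt u + sqrt v) \<le> 2 * sqrt (32 * m)"
  proof -
    have "real (Suc k) * sqrt v \<le> real (Suc k) * sqrt u" using v by (intro mult_left_mono) auto
    with \<open>real (Suc k) * sqrt u \<le> sqrt (32 * m)\<close> show ?thesis unfolding distrib_left by linarith
  qed
  have "real (Suc k) * (u - v) = real (Suc k) * (sqrt u + sqrt v) * (sqrt u - sqrt v)"
  proof -
    have "(sqrt u + sqrt v) * (sqrt u - sqrt v) = u - v"
      using u_pos v by (simp add: algebra_simps)
    then show ?thesis by (simp add: mult.assoc)
  qed
  also have "\<dots> \<le> 2 * sqrt (32 * m) * (sqrt u - sqrt v)"
    using key v by (intro mult_right_mono) auto
  also have "2 * sqrt (32 * m) = sqrt (128 * m)"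
    using real_sqrt_mult[of 4 "32 * m"] by simp
  finally have "cheaper (sqrt (128 * measure \<mu> C)) \<sigma> \<tau>"
    using \<tau>(3) unfolding cheaper_def m_def u_def v_def by linarith
  then show thesis using that \<tau> by blast
qed

lemma perfect_matching:
  obtains \<sigma> where "matching \<sigma>" "C - dom \<sigma> \<in> null_sets \<mu>" "D - move \<phi> \<sigma> ` dom \<sigma> \<in> null_sets \<mu>"
proof -
  have empty: "matching Map.empty" by (simp add: matching_def)
  have "\<exists>\<sigma>. matching \<sigma> \<and> deficiency \<sigma> = 0"
  proof (cases "measure \<mu> C = 0")
    case True
    then have "deficiency Map.empty = 0" by (simp add: deficiency_def)
    then show ?thesis using empty by blast
  next
    case False
    define c where "c = sqrt (128 * measure \<mu> C)"
    have c: "0 < c"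
      using False measure_nonneg[of \<mu> C] unfolding c_def by (simp add: less_le)
    obtain \<sigma> where \<sigma>: "matching \<sigma>"
      and max: "\<And>\<tau>. matching \<tau> \<Longrightarrow> cheaper c \<sigma> \<tau> \<Longrightarrow> deficiency \<tau> = deficiency \<sigma>"
    proof (rule brezis_browder[of matching Map.empty "cheaper c" deficiency])
      show "cheaper c \<sigma> \<sigma>" for \<sigma> by (simp add: cheaper_def)
      show "\<exists>\<tau>. matching \<tau> \<and> (\<forall>n. cheaper c (s n) \<tau>)"
        if "\<And>n. matching (s n)" "\<And>n. cheaper c (s n) (s (Suc n))" for s
        using that c
        by (intro exI[of _ "eventual_value s"] conjI allI matching_eventual_value cheaper_eventual_value)
      show "cheaper c \<sigma> \<rho>" if "matching \<sigma>" "matching \<tau>" "matching \<rho>" "cheaper c \<sigma> \<tau>" "cheaper c \<tau> \<rho>"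
        for \<sigma> \<tau> \<rho> using that by (rule cheaper_trans)
      show "deficiency \<tau> \<le> deficiency \<sigma>" if "cheaper c \<sigma> \<tau>" for \<sigma> \<tau>
        using c that by (rule cheaper_deficiency)
    qed (rule empty, rule deficiency_nonneg, rule that)
    have "deficiency \<sigma> = 0"
    proof (rule ccontr)
      assume "deficiency \<sigma> \<noteq> 0"
      then have "0 < deficiency \<sigma>" using deficiency_nonneg[of \<sigma>] by linarith
      from improve[OF \<sigma> this] max show False unfolding c_def by (metis less_irrefl)
    qed
    then show ?thesis using \<sigma> by blast
  qed
  then obtain \<sigma> where \<sigma>: "matching \<sigma>" "deficiency \<sigma> = 0" by blast
  have R: "move \<phi> \<sigma> ` dom \<sigma> \<in> sets \<mu>" "move \<phi> \<sigma> ` dom \<sigma> \<subseteq> D"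
    using sets_move[OF \<sigma>(1) sets_dom[OF \<sigma>(1)]] matchingD(5)[OF \<sigma>(1)] by auto
  have null: "E \<in> null_sets \<mu>" if "E \<in> fmeasurable \<mu>" "measure \<mu> E = 0" for E
    using that emeasure_eq_measure2[OF that(1)] by (auto simp: null_sets_def)
  show thesis
  proof (rule that[OF \<sigma>(1)])
    show "C - dom \<sigma> \<in> null_sets \<mu>"
      using \<sigma> sets_dom by (intro null fmeasurable_C) (auto simp: deficiency_def)
    show "D - move \<phi> \<sigma> ` dom \<sigma> \<in> null_sets \<mu>"
      using \<sigma> R measure_Diff_D[OF R] deficiency_range[OF \<sigma>(1)]
      by (intro null fmeasurable_D) auto
  qed
qed

end

section \<open>Expansion between mutually covering sets\<close>

context measure_preserving_action
begin

lemma fmeasurable_translates: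
  assumes "finite T" "T \<subseteq> carrier G" "X \<in> fmeasurable \<mu>"
  shows "translates \<phi> T X \<in> fmeasurable \<mu>"
proof -
  have "\<phi> g ` X \<in> fmeasurable \<mu>" if "g \<in> T" for g
    using assms that by (auto simp: fmeasurable_def emeasure_image subset_iff intro: sets_image)
  then show ?thesis
    unfolding translates_def using assms(1) by (intro fmeasurable.finite_UN) auto
qed

text \<open>
  If translates of \<open>Y\<close> by \<open>T\<close> cover \<open>X\<close>, then moving \<open>X\<close> back into \<open>Y\<close> keeps at least the
  proportion \<open>1 / card T\<close> of its measure: the translates of what arrives in \<open>Y\<close> still cover \<open>X\<close>.
\<close>

lemma measure_le_of_cover:
  assumes T: "finite T" "T \<subseteq> K" and K: "finite K" "K \<subseteq> carrier G" "\<And>g. g \<in> K \<Longrightarrow> inv g \<in> K"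
    and N: "N \<in> null_sets \<mu>" and X: "X \<in> fmeasurable \<mu>" and Y: "Y \<in> sets \<mu>"
    and cover: "X - N \<subseteq> translates \<phi> T Y"
  shows "measure \<mu> X \<le> card T * measure \<mu> (translates \<phi> K X \<inter> Y)"
proof -
  let ?Z = "translates \<phi> K X \<inter> Y"
  have Z: "?Z \<in> fmeasurable \<mu>"
    using fmeasurable_translates[OF K(1,2) X] Y by (rule fmeasurable_Int_fmeasurable)
  have Tc: "T \<subseteq> carrier G" using T K by blast
  have sub: "X - N \<subseteq> translates \<phi> T ?Z"
  proof
    fix x assume x: "x \<in> X - N"
    then obtain g y where g: "g \<in> T" "y \<in> Y" "x = \<phi> g y"
      using cover by (auto simp: translates_def)
    have "g \<in> K" using g(1) T(2) by blast
    moreover have "\<phi> g y \<in> X" using x g(3) by simp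
    ultimately have "y \<in> translates \<phi> K X"
      by (subst mem_translates_symmetric[OF K(2)]) (auto intro: K(3))
    then show "x \<in> translates \<phi> T ?Z" using g by (auto simp: translates_def)
  qed
  have "measure \<mu> X = measure \<mu> (X - N)"
    using X N by (simp add: measure_Diff_null_set fmeasurableD)
  also have "\<dots> \<le> measure \<mu> (translates \<phi> T ?Z)"
    using sub X N fmeasurable_translates[OF T(1) Tc Z] by (intro measure_mono_fmeasurable) auto
  also have "\<dots> \<le> (\<Sum>g\<in>T. measure \<mu> (\<phi> g ` ?Z))"
    unfolding translates_def[of _ T] using T Tc Z by (intro measure_UNION_le sets_image) auto
  also have "\<dots> = (\<Sum>g\<in>T. measure \<mu> ?Z)"
    using Tc Z by (intro sum.cong) (auto intro!: measure_image)
  finally show ?thesis by simp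
qed

lemma translates_set_mult:
  assumes "K \<subseteq> carrier G"
  shows "translates \<phi> (K <#> K) X = translates \<phi> K (translates \<phi> K X)"
  using assms by (fastforce simp: translates_def set_mult_def composition_rule subset_iff image_iff)

text \<open>
  All moves are made by elements of a symmetric set \<open>K\<close>; a move between \<open>A\<close> and \<open>B\<close> loses a factor
  \<open>n\<close> at most, while a move inside \<open>A\<close> gains the factor \<open>1 / \<eta> = 3 * n\<close>. Hence one move of each kind, in
  either order, at least triples small sets. A set that moves from \<open>B\<close> to \<open>A\<close> and then inside \<open>A\<close> stops
  growing only when it fills \<open>1 - \<eta> \<ge> 2/3\<close> of \<open>A\<close>. In the other direction, a subset of \<open>A\<close> that has grown
  to \<open>1 - \<eta>\<close> of \<open>A\<close> reaches most of \<open>B\<close>: the rest of \<open>B\<close> can only be moved to the remaining \<open>\<eta>\<close> of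
  \<open>A\<close>, so it has at most the proportion \<open>n * \<eta> = 1/3\<close>.
\<close>

lemma expanding_between_covering_sets:
  assumes A: "A \<in> fmeasurable \<mu>" and B: "B \<in> fmeasurable \<mu>" and eq: "measure \<mu> B = measure \<mu> A"
    and T: "finite T" "T \<subseteq> carrier G" and N: "N \<in> null_sets \<mu>"
    and AB: "A - N \<subseteq> translates \<phi> T B" and BA: "B - N \<subseteq> translates \<phi> T A"
    and expansion: "\<And>\<eta>::real. 0 < \<eta> \<Longrightarrow> \<exists>R. finite R \<and> R \<subseteq> carrier G \<and>
      (\<forall>Y\<in>sets \<mu>. Y \<subseteq> A \<longrightarrow>
        min ((1 - \<eta>) * measure \<mu> A) (measure \<mu> Y / \<eta>) \<le> measure \<mu> (translates \<phi> R Y \<inter> A))"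
  obtains S where "expanding_action_graph G \<phi> \<mu> S B A"
proof -
  define a where "a = measure \<mu> A"
  define n where "n = real (card T) + 1"
  define \<eta> where "\<eta> = 1 / (3 * n)"
  have n: "1 \<le> n" by (simp add: n_def)
  have \<eta>: "0 < \<eta>" "\<eta> \<le> 1/3" "n * \<eta> = 1/3" using n by (auto simp: \<eta>_def field_simps)
  have a: "0 \<le> a" by (simp add: a_def)
  have big: "2/3 * a \<le> (1 - \<eta>) * a" using \<eta> a by (intro mult_right_mono) auto
  have div_\<eta>: "v / \<eta> = 3 * (n * v)" for v using n by (simp add: \<eta>_def field_simps)
  obtain R where R: "finite R" "R \<subseteq> carrier G"
    and exp_R: "\<And>Y. Y \<in> sets \<mu> \<Longrightarrow> Y \<subseteq> A \<Longrightarrow>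
      min ((1 - \<eta>) * a) (3 * (n * measure \<mu> Y)) \<le> measure \<mu> (translates \<phi> R Y \<inter> A)"
    using expansion[OF \<eta>(1)] unfolding a_def div_\<eta> by blast
  obtain K where K: "finite K" "K \<subseteq> carrier G" "T \<union> R \<subseteq> K" and K_inv: "\<And>g. g \<in> K \<Longrightarrow> inv g \<in> K"
    using finite_symmetric_superset[of "T \<union> R"] T R by (metis finite_UnI Un_least)
  let ?t = "translates \<phi> K"
  have sets_t: "?t X \<in> sets \<mu>" if "X \<in> sets \<mu>" for X using K that by auto
  have cover: "measure \<mu> X \<le> n * measure \<mu> (?t X \<inter> Y)"
    if "X \<in> fmeasurable \<mu>" "Y \<in> sets \<mu>" "X - N \<subseteq> translates \<phi> T Y" for X Y
  proof -
    have "measure \<mu> X \<le> card T * measure \<mu> (?t X \<inter> Y)"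
      using K T K_inv N that by (intro measure_le_of_cover) auto
    also have "\<dots> \<le> n * measure \<mu> (?t X \<inter> Y)" by (intro mult_right_mono) (auto simp: n_def)
    finally show ?thesis .
  qed
  have cover_A: "measure \<mu> X \<le> n * measure \<mu> (?t X \<inter> B)" if "X \<in> sets \<mu>" "X \<subseteq> A" for X
    using fmeasurableI2[OF A that(2,1)] fmeasurableD[OF B]
    by (rule cover) (use AB that(2) in blast)
  have cover_B: "measure \<mu> X \<le> n * measure \<mu> (?t X \<inter> A)" if "X \<in> sets \<mu>" "X \<subseteq> B" for X
    using fmeasurableI2[OF B that(2,1)] fmeasurableD[OF A]
    by (rule cover) (use BA that(2) in blast)
  have mono_Int: "measure \<mu> (P \<inter> E) \<le> measure \<mu> (P' \<inter> E)"
    if P: "P \<subseteq> P'" "P \<in> sets \<mu>" "P' \<in> sets \<mu>" and E: "E \<in> fmeasurable \<mu>" for P P' E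
    by (intro measure_mono_fmeasurable fmeasurableI2[OF E]) (use P fmeasurableD[OF E] in auto)
  have exp_K: "min ((1 - \<eta>) * a) (3 * (n * measure \<mu> Y)) \<le> measure \<mu> (?t Y \<inter> A)"
    if Y: "Y \<in> sets \<mu>" "Y \<subseteq> A" for Y
  proof -
    have "measure \<mu> (translates \<phi> R Y \<inter> A) \<le> measure \<mu> (?t Y \<inter> A)"
      using K(3) by (intro mono_Int translates_mono sets_translates R Y(1) sets_t A) auto
    then show ?thesis using exp_R[OF Y] by linarith
  qed
  have "expanding_action_graph G \<phi> \<mu> (K <#> K) B A"
  proof unfold_locales
    show "finite (K <#> K)" unfolding set_mult_def using K(1) by auto
    show "K <#> K \<subseteq> carrier G"
      unfolding set_mult_def using K(2)
      by (auto simp: subset_iff intro!: monoid.m_closed[OF group.is_monoid[OF is_group]])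
    show "inv g \<in> K <#> K" if "g \<in> K <#> K" for g
    proof -
      obtain x y where "x \<in> K" "y \<in> K" "g = x \<otimes> y" using \<open>g \<in> K <#> K\<close> by (auto simp: set_mult_def)
      then have "inv g = inv y \<otimes> inv x" "inv y \<in> K" "inv x \<in> K"
        using K(2) K_inv by (auto simp: group.inv_mult_group[OF is_group] subset_iff)
      then show ?thesis unfolding set_mult_def by blast
    qed
    show "B \<in> fmeasurable \<mu>" "A \<in> fmeasurable \<mu>" "measure \<mu> B = measure \<mu> A" by fact+
    fix X assume X: "X \<in> sets \<mu>"
    let ?tt = "translates \<phi> (K <#> K) X"
    have tt: "?tt = ?t (?t X)" using K(2) by (rule translates_set_mult)
    define Z where "Z = ?t X \<inter> A"
    have Z: "Z \<in> sets \<mu>" "Z \<subseteq> A" using sets_t[OF X] A by (auto simp: Z_def)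
    have tZ: "?t Z \<subseteq> ?tt" unfolding tt Z_def by (intro translates_mono) auto
    have sets_tt: "?tt \<in> sets \<mu>" unfolding tt using sets_t X by blast
    show "min (2/3 * measure \<mu> B) (2 * measure \<mu> X) \<le> measure \<mu> (?tt \<inter> A)" if "X \<subseteq> B"
    proof -
      have "measure \<mu> X \<le> n * measure \<mu> Z"
        unfolding Z_def using X that by (rule cover_B)
      moreover have "min ((1 - \<eta>) * a) (3 * (n * measure \<mu> Z)) \<le> measure \<mu> (?t Z \<inter> A)"
        using Z by (rule exp_K)
      moreover have "measure \<mu> (?t Z \<inter> A) \<le> measure \<mu> (?tt \<inter> A)"
        using tZ sets_t[OF Z(1)] sets_tt A by (rule mono_Int)
      moreover have "0 \<le> measure \<mu> X" by simp
      ultimately show ?thesis using big unfolding eq a_def[symmetric] by linarith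
    qed
    show "min (2/3 * measure \<mu> B) (2 * measure \<mu> X) \<le> measure \<mu> (?tt \<inter> B)" if XA: "X \<subseteq> A"
    proof -
      have mono: "measure \<mu> (?t Z \<inter> B) \<le> measure \<mu> (?tt \<inter> B)"
        using tZ sets_t[OF Z(1)] sets_tt B by (rule mono_Int)
      have exp_X: "min ((1 - \<eta>) * a) (3 * (n * measure \<mu> X)) \<le> measure \<mu> Z"
        unfolding Z_def using X XA by (rule exp_K)
      have "measure \<mu> Z \<le> n * measure \<mu> (?t Z \<inter> B)"
        using Z by (rule cover_A)
      show ?thesis
      proof (cases "3 * (n * measure \<mu> X) \<le> measure \<mu> Z")
        case True
        then have "n * (3 * measure \<mu> X) \<le> n * measure \<mu> (?t Z \<inter> B)"
          using \<open>measure \<mu> Z \<le> n * measure \<mu> (?t Z \<inter> B)\<close> by (simp add: algebra_simps)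
        then have "3 * measure \<mu> X \<le> measure \<mu> (?t Z \<inter> B)" using n by simp
        moreover have "0 \<le> measure \<mu> X" by simp
        ultimately show ?thesis using mono by linarith
      next
        case False
        define W where "W = B - ?t Z"
        have W: "W \<in> sets \<mu>" "W \<subseteq> B" using sets_t[OF Z(1)] B by (auto simp: W_def)
        have "measure \<mu> W \<le> n * measure \<mu> (?t W \<inter> A)"
          using W by (rule cover_B)
        also have "\<dots> \<le> n * measure \<mu> (A - Z)"
        proof -
          have "?t W \<inter> A \<subseteq> A - Z"
          proof
            fix x assume x: "x \<in> ?t W \<inter> A"
            then obtain g where g: "g \<in> K" "\<phi> g x \<in> W"
              using mem_translates_symmetric[OF K(2) K_inv, of x W] by blast
            then have "x \<notin> Z" by (auto simp: W_def translates_def)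
            then show "x \<in> A - Z" using x by blast
          qed
          then have "measure \<mu> (?t W \<inter> A) \<le> measure \<mu> (A - Z)"
            using sets_t[OF W(1)] Z(1) A
            by (intro measure_mono_fmeasurable fmeasurable_Diff) auto
          then show ?thesis using n by (intro mult_left_mono) auto
        qed
        also have "measure \<mu> (A - Z) = a - measure \<mu> Z"
          unfolding a_def using measurable_measure_Diff[OF A Z] .
        also have "n * (a - measure \<mu> Z) \<le> n * (\<eta> * a)"
          using n False exp_X by (intro mult_left_mono) (auto simp: algebra_simps)
        also have "\<dots> = a / 3" using \<eta>(3) by (simp flip: mult.assoc)
        finally have "measure \<mu> W \<le> a / 3" .
        moreover have "measure \<mu> W = a - measure \<mu> (?t Z \<inter> B)"
        proof -
          have "W = B - (?t Z \<inter> B)" by (auto simp: W_def)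
          then show ?thesis
            using measurable_measure_Diff[OF B, of "?t Z \<inter> B"] sets_t[OF Z(1)] B
            by (auto simp: eq a_def)
        qed
        ultimately show ?thesis using mono unfolding eq a_def[symmetric] by linarith
      qed
    qed
  qed
  then show thesis by (rule that)
qed

text \<open>
  Invariance under finitely many elements needs only countably many iterated translates, even if
  the group is uncountable.
\<close>

lemma invariant_null_set:
  assumes "finite F" "F \<subseteq> carrier G" "N \<in> null_sets \<mu>"
  obtains Q where "Q \<in> null_sets \<mu>" "N \<subseteq> Q" "\<And>g x. g \<in> F \<Longrightarrow> \<phi> g x \<in> Q \<longleftrightarrow> x \<in> Q"
proof -
  obtain K where K: "finite K" "K \<subseteq> carrier G" "F \<subseteq> K" and K_inv: "\<And>g. g \<in> K \<Longrightarrow> inv g \<in> K"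
    using finite_symmetric_superset assms by metis
  define Q where "Q = (\<Union>k. (translates \<phi> K ^^ k) N)"
  have "(translates \<phi> K ^^ k) N \<in> null_sets \<mu>" for k
    using assms(3) K null_sets_translates by (induction k) auto
  then have null: "Q \<in> null_sets \<mu>" unfolding Q_def by blast
  have sub: "N \<subseteq> Q" unfolding Q_def by (metis UN_upper UNIV_I funpow_0)
  have closed: "\<phi> g x \<in> Q" if g: "g \<in> K" and x: "x \<in> Q" for g x
  proof -
    obtain k where "x \<in> (translates \<phi> K ^^ k) N" using x by (auto simp: Q_def)
    then have "\<phi> g x \<in> (translates \<phi> K ^^ Suc k) N" using g by (auto simp: translates_def)
    then show ?thesis unfolding Q_def by blast
  qed
  have reflected: "x \<in> Q" if "g \<in> F" "\<phi> g x \<in> Q" for g x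
  proof -
    have "g \<in> K" "g \<in> carrier G" using that(1) K by auto
    then show ?thesis using closed[OF K_inv that(2), of g] by simp
  qed
  show thesis
  proof (rule that[OF null sub])
    show "\<phi> g x \<in> Q \<longleftrightarrow> x \<in> Q" if "g \<in> F" for g x
      using closed[of g x] reflected[of g x] that K(3) by blast
  qed
qed

end

section \<open>The two characterizations\<close>

context borel_measure_preserving_action
begin

lemma expanding_action_graph_domain_of_expansion:
  assumes A: "domain_of_expansion G \<phi> M A"
    and AB: "essentially_covers G \<phi> M A B" and BA: "essentially_covers G \<phi> M B A"
    and B: "B \<in> sets (completion M)" and eq: "emeasure (completion M) A = emeasure (completion M) B"
  obtains S where "expanding_action_graph G \<phi> (completion M) S B A"
proof -
  interpret measure_preserving_action G \<phi> "completion M"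
    by (rule measure_preserving_action_completion)
  obtain N T where N: "N \<in> null_sets (completion M)" "finite T" "T \<subseteq> carrier G"
      "B - N \<subseteq> translates \<phi> T A"
    using AB by (auto simp: essentially_covers_def covers_def)
  obtain N' T' where N': "N' \<in> null_sets (completion M)" "finite T'" "T' \<subseteq> carrier G"
      "A - N' \<subseteq> translates \<phi> T' B"
    using BA by (auto simp: essentially_covers_def covers_def)
  show thesis
  proof (rule expanding_between_covering_sets[OF _ _ _ _ _ _ _ _ _ that])
    show "A \<in> fmeasurable (completion M)"
      using A by (auto simp: domain_of_expansion_def intro: fmeasurableI)
    then show "B \<in> fmeasurable (completion M)"
      using B eq by (simp add: fmeasurable_def)
    show "measure (completion M) B = measure (completion M) A"
      using eq by (simp add: measure_def)
    show "A - (N \<union> N') \<subseteq> translates \<phi> (T \<union> T') B" "B - (N \<union> N') \<subseteq> translates \<phi> (T \<union> T') A"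
      using N(4) N'(4) by (auto simp: translates_def)
    show "finite (T \<union> T')" "T \<union> T' \<subseteq> carrier G" "N \<union> N' \<in> null_sets (completion M)"
      using N N' by auto
  qed (use A in \<open>simp add: domain_of_expansion_def\<close>)
qed

lemma essentially_borel_equidecomposable_imp:
  assumes "essentially_borel_equidecomposable G \<phi> M B A"
  shows "essentially_covers G \<phi> M A B" "essentially_covers G \<phi> M B A"
    "emeasure (completion M) A = emeasure (completion M) B"
proof -
  interpret measure_preserving_action G \<phi> "completion M"
    by (rule measure_preserving_action_completion)
  obtain N N' where N: "N \<in> null_sets (completion M)" "N' \<in> null_sets (completion M)"
      and AB: "A \<in> sets (completion M)" "B \<in> sets (completion M)"
      and eq: "equidecomposable G \<phi> (sets borel) (B - N) (A - N')"
    using assms by (auto simp: essentially_borel_equidecomposable_def borel_equidecomposable_def)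
  have "set_equidecomposable G \<phi> (B - N) (A - N')"
    unfolding set_equidecomposable_def using eq by (rule equidecomposable_mono) simp
  from equidecomposable_imp_covers[OF set_equidecomposable_sym[OF this, unfolded set_equidecomposable_def]]
  show "essentially_covers G \<phi> M A B"
    unfolding essentially_covers_def using N covers_mono by blast
  show "essentially_covers G \<phi> M B A"
    unfolding essentially_covers_def using N covers_mono equidecomposable_imp_covers[OF eq] by blast
  have "equidecomposable G \<phi> (sets (completion M)) (B - N) (A - N')"
    using eq by (rule equidecomposable_mono) (auto simp: sets_M[symmetric])
  then have "emeasure (completion M) (B - N) = emeasure (completion M) (A - N')"
    by (rule measurable_equidecomposable_emeasure)
  then show "emeasure (completion M) A = emeasure (completion M) B"
    using N AB by (simp add: emeasure_Diff_null_set)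
qed

text \<open>
  The pieces of the perfect matching are replaced by their Borel parts, which removes a null set
  from the domain and hence from the range.
\<close>

lemma essentially_borel_equidecomposable_expanding:
  assumes "expanding_action_graph G \<phi> (completion M) S B A"
  shows "essentially_borel_equidecomposable G \<phi> M B A"
proof -
  interpret expanding_action_graph G \<phi> "completion M" S B A by fact
  obtain \<sigma> where \<sigma>: "matching \<sigma>" "B - dom \<sigma> \<in> null_sets (completion M)"
      "A - move \<phi> \<sigma> ` dom \<sigma> \<in> null_sets (completion M)"
    by (rule perfect_matching)
  define P where "P g = main_part M {x. \<sigma> x = Some g}" for g
  define B0 where "B0 = (\<Union>g\<in>S. P g)"
  have piece: "{x. \<sigma> x = Some g} = P g \<union> null_part M {x. \<sigma> x = Some g}" for g
    unfolding P_def using main_part_null_part_Un[OF matchingD(3)[OF \<sigma>(1)]] by simp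
  have P_borel: "P g \<in> sets borel" for g
    unfolding P_def using main_part_sets[OF matchingD(3)[OF \<sigma>(1)]] by (simp add: sets_M)
  have P: "\<sigma> x = Some g" if "x \<in> P g" for x g
    using piece[of g] that by blast
  have B0_dom: "B0 \<subseteq> dom \<sigma>" using P by (auto simp: B0_def)
  have "dom \<sigma> - B0 \<subseteq> (\<Union>g\<in>S. null_part M {x. \<sigma> x = Some g})"
  proof
    fix x assume x: "x \<in> dom \<sigma> - B0"
    then obtain g where g: "\<sigma> x = Some g" by auto
    then have "g \<in> S" by (rule matchingD(6)[OF \<sigma>(1)])
    then show "x \<in> (\<Union>g\<in>S. null_part M {x. \<sigma> x = Some g})"
      using x g piece[of g] by (auto simp: B0_def)
  qed
  moreover have "(\<Union>g\<in>S. null_part M {x. \<sigma> x = Some g}) \<in> null_sets (completion M)"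
    by (intro null_sets.finite_UN finite_S null_part_null_sets matchingD(3)[OF \<sigma>(1)])
  ultimately have lost: "dom \<sigma> - B0 \<in> null_sets (completion M)"
    by (rule null_sets_completion_subset)
  have lost_image: "move \<phi> \<sigma> ` (dom \<sigma> - B0) \<in> null_sets (completion M)"
  proof (rule null_setsI)
    have sets: "dom \<sigma> - B0 \<in> sets (completion M)" using lost by (rule null_setsD2)
    show "move \<phi> \<sigma> ` (dom \<sigma> - B0) \<in> sets (completion M)"
      using \<sigma>(1) sets Diff_subset by (rule sets_move)
    show "emeasure (completion M) (move \<phi> \<sigma> ` (dom \<sigma> - B0)) = 0"
      using emeasure_move[OF \<sigma>(1) sets Diff_subset] null_setsD1[OF lost] by (rule trans)
  qed
  have "equidecomposable G \<phi> (sets borel) B0 (move \<phi> \<sigma> ` B0)"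
  proof (rule equidecomposableI[where F = S and \<rho> = "\<lambda>x. the (\<sigma> x)"])
    show "(\<lambda>x. the (\<sigma> x)) ` B0 \<subseteq> S" using P by (auto simp: B0_def)
    show "{x \<in> B0. the (\<sigma> x) = g} \<in> sets borel" if "g \<in> S" for g
    proof -
      have "{x \<in> B0. the (\<sigma> x) = g} = P g" using P that by (auto simp: B0_def)
      then show ?thesis using P_borel by simp
    qed
    show "bij_betw (\<lambda>x. \<phi> (the (\<sigma> x)) x) B0 (move \<phi> \<sigma> ` B0)"
      using inj_on_subset[OF matchingD(4)[OF \<sigma>(1)] B0_dom]
      by (simp add: bij_betw_def move_def[abs_def])
  qed (use finite_S S_carrier in auto)
  moreover have "B - (B - B0) = B0"
    using B0_dom matchingD(1)[OF \<sigma>(1)] by blast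
  moreover have "A - (A - move \<phi> \<sigma> ` B0) = move \<phi> \<sigma> ` B0"
    using B0_dom matchingD(5)[OF \<sigma>(1)] by blast
  ultimately have equi: "borel_equidecomposable G \<phi> (B - (B - B0)) (A - (A - move \<phi> \<sigma> ` B0))"
    by (simp add: borel_equidecomposable_def)
  have "B - B0 \<in> null_sets (completion M)"
    by (rule null_sets_completion_subset[OF _ null_sets.Un[OF \<sigma>(2) lost]]) blast
  moreover have "A - move \<phi> \<sigma> ` B0 \<in> null_sets (completion M)"
    by (rule null_sets_completion_subset[OF _ null_sets.Un[OF \<sigma>(3) lost_image]]) blast
  ultimately show ?thesis
    unfolding essentially_borel_equidecomposable_def using equi by blast
qed

text \<open>
  Off an invariant null set \<open>Q\<close> that contains all unmatched points of both sides, the perfect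
  matching is a bijection; on \<open>Q\<close>, the set-theoretic equidecomposition is one. Both preserve \<open>Q\<close>,
  so they can be glued.
\<close>

lemma measurably_equidecomposable_expanding:
  assumes "expanding_action_graph G \<phi> (completion M) S B A" and "set_equidecomposable G \<phi> B A"
  shows "measurably_equidecomposable G \<phi> M B A"
proof -
  interpret expanding_action_graph G \<phi> "completion M" S B A by fact
  obtain \<sigma> where \<sigma>: "matching \<sigma>" "B - dom \<sigma> \<in> null_sets (completion M)"
      "A - move \<phi> \<sigma> ` dom \<sigma> \<in> null_sets (completion M)"
    by (rule perfect_matching)
  obtain F \<rho> where F: "finite F" "F \<subseteq> carrier G" "\<rho> ` B \<subseteq> F" "bij_betw (\<lambda>x. \<phi> (\<rho> x) x) B A"
    using assms(2) equidecomposableE inj_act unfolding set_equidecomposable_def by metis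
  obtain Q where Q: "Q \<in> null_sets (completion M)"
      "(B - dom \<sigma>) \<union> (A - move \<phi> \<sigma> ` dom \<sigma>) \<subseteq> Q"
      and inv_Q: "\<And>g x. g \<in> F \<union> S \<Longrightarrow> \<phi> g x \<in> Q \<longleftrightarrow> x \<in> Q"
  proof (rule invariant_null_set)
    show "finite (F \<union> S)" "F \<union> S \<subseteq> carrier G" using F finite_S S_carrier by auto
    show "(B - dom \<sigma>) \<union> (A - move \<phi> \<sigma> ` dom \<sigma>) \<in> null_sets (completion M)"
      using \<sigma>(2,3) by (rule null_sets.Un)
  qed (rule that)
  define \<theta> where "\<theta> x = (if x \<in> Q then \<rho> x else the (\<sigma> x))" for x
  have \<sigma>_S: "the (\<sigma> x) \<in> S" if "x \<in> B - Q" for x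
  proof -
    have "x \<in> dom \<sigma>" using that Q(2) by blast
    then show ?thesis using matchingD(6)[OF \<sigma>(1)] by auto
  qed
  have "bij_betw (\<lambda>x. \<phi> (\<theta> x) x) (B \<inter> Q) (A \<inter> Q)"
  proof -
    have "bij_betw (\<lambda>x. \<phi> (\<rho> x) x) (B \<inter> Q) ((\<lambda>x. \<phi> (\<rho> x) x) ` (B \<inter> Q))"
      using F(4) by (rule bij_betw_subset) auto
    moreover have "(\<lambda>x. \<phi> (\<rho> x) x) ` (B \<inter> Q) = A \<inter> Q"
    proof -
      have "\<phi> (\<rho> x) x \<in> Q \<longleftrightarrow> x \<in> Q" if "x \<in> B" for x
        using inv_Q F(3) that by blast
      then show ?thesis
        unfolding bij_betw_imp_surj_on[OF F(4), symmetric] by auto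
    qed
    ultimately have "bij_betw (\<lambda>x. \<phi> (\<rho> x) x) (B \<inter> Q) (A \<inter> Q)" by simp
    then show ?thesis
      by (rule bij_betw_cong[THEN iffD1, rotated]) (simp add: \<theta>_def)
  qed
  moreover have "bij_betw (\<lambda>x. \<phi> (\<theta> x) x) (B - Q) (A - Q)"
  proof -
    have dom: "B - Q \<subseteq> dom \<sigma>" using Q(2) by blast
    have inv: "move \<phi> \<sigma> x \<in> Q \<longleftrightarrow> x \<in> Q" if "x \<in> dom \<sigma>" for x
      using that inv_Q matchingD(6)[OF \<sigma>(1)] by (auto simp: move_def)
    have "inj_on (move \<phi> \<sigma>) (B - Q)" using matchingD(4)[OF \<sigma>(1)] dom by (rule inj_on_subset)
    moreover have "move \<phi> \<sigma> ` (B - Q) = A - Q"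
    proof (intro equalityI subsetI)
      fix y assume "y \<in> move \<phi> \<sigma> ` (B - Q)"
      then show "y \<in> A - Q" using dom inv matchingD(5)[OF \<sigma>(1)] by blast
    next
      fix y assume y: "y \<in> A - Q"
      then obtain x where "x \<in> dom \<sigma>" "y = move \<phi> \<sigma> x" using Q(2) by blast
      then show "y \<in> move \<phi> \<sigma> ` (B - Q)" using y inv matchingD(1)[OF \<sigma>(1)] by blast
    qed
    ultimately have "bij_betw (move \<phi> \<sigma>) (B - Q) (A - Q)" by (simp add: bij_betw_def)
    then show ?thesis
      by (rule bij_betw_cong[THEN iffD1, rotated]) (simp add: \<theta>_def move_def)
  qed
  ultimately have "bij_betw (\<lambda>x. \<phi> (\<theta> x) x) ((B \<inter> Q) \<union> (B - Q)) ((A \<inter> Q) \<union> (A - Q))"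
    by (rule bij_betw_combine) auto
  then have bij: "bij_betw (\<lambda>x. \<phi> (\<theta> x) x) B A" by (simp add: Un_Diff_Int Un_commute)
  have "{x \<in> B. \<theta> x = g} \<in> sets (completion M)" for g
  proof -
    have "{x \<in> B. \<theta> x = g} = {x \<in> B \<inter> Q. \<rho> x = g} \<union> ({x. \<sigma> x = Some g} - Q)"
      using Q(2) matchingD(1)[OF \<sigma>(1)] by (auto simp: \<theta>_def split: if_splits)
    also have "\<dots> \<in> sets (completion M)"
    proof (intro sets.Un sets.Diff)
      show "{x \<in> B \<inter> Q. \<rho> x = g} \<in> sets (completion M)"
        by (rule null_setsD2, rule null_sets_completion_subset[OF _ Q(1)]) blast
      show "{x. \<sigma> x = Some g} \<in> sets (completion M)" by (rule matchingD(3)[OF \<sigma>(1)])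
      show "Q \<in> sets (completion M)" using Q(1) by (rule null_setsD2)
    qed
    finally show ?thesis .
  qed
  then show ?thesis
    unfolding measurably_equidecomposable_def using F finite_S S_carrier \<sigma>_S bij
    by (intro equidecomposableI[where F = "F \<union> S" and \<rho> = \<theta>]) (auto simp: \<theta>_def)
qed

end

theorem theorem1p6:
  fixes G :: "('g, 'b) monoid_scheme"
    and \<phi> :: "'g \<Rightarrow> 'a::polish_space \<Rightarrow> 'a"
    and M :: "'a measure"
    and A :: "'a set"
  assumes "borel_measure_preserving_action G \<phi> M"
    and "domain_of_expansion G \<phi> M A"
  shows "(\<forall>B. essentially_borel_equidecomposable G \<phi> M B A \<longleftrightarrow>
            essentially_covers G \<phi> M A B \<and> essentially_covers G \<phi> M B A \<and>
            B \<in> sets (completion M) \<and>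
            emeasure (completion M) A = emeasure (completion M) B)
       \<and> (\<forall>B. measurably_equidecomposable G \<phi> M B A \<longleftrightarrow>
            set_equidecomposable G \<phi> A B \<and>
            B \<in> sets (completion M) \<and>
            emeasure (completion M) A = emeasure (completion M) B)"
proof -
  interpret borel_measure_preserving_action G \<phi> M by fact
  interpret c: measure_preserving_action G \<phi> "completion M"
    by (rule measure_preserving_action_completion)
  have "essentially_borel_equidecomposable G \<phi> M B A"
    if "essentially_covers G \<phi> M A B \<and> essentially_covers G \<phi> M B A \<and>
      B \<in> sets (completion M) \<and> emeasure (completion M) A = emeasure (completion M) B" for B
    using that expanding_action_graph_domain_of_expansion[OF assms(2)]
      essentially_borel_equidecomposable_expanding by metis
  moreover have "essentially_covers G \<phi> M A B \<and> essentially_covers G \<phi> M B A \<and>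
      B \<in> sets (completion M) \<and> emeasure (completion M) A = emeasure (completion M) B"
    if "essentially_borel_equidecomposable G \<phi> M B A" for B
    using essentially_borel_equidecomposable_imp[OF that] that
    by (simp add: essentially_borel_equidecomposable_def)
  moreover have "measurably_equidecomposable G \<phi> M B A"
    if *: "set_equidecomposable G \<phi> A B" "B \<in> sets (completion M)"
      "emeasure (completion M) A = emeasure (completion M) B" for B
  proof -
    have BA: "set_equidecomposable G \<phi> B A"
      using *(1) by (rule c.set_equidecomposable_sym)
    have "covers G \<phi> A B" "covers G \<phi> B A"
      using c.equidecomposable_imp_covers *(1) BA unfolding set_equidecomposable_def by blast+
    then have "essentially_covers G \<phi> M A B" "essentially_covers G \<phi> M B A"
      unfolding essentially_covers_def by (auto intro!: bexI[of _ "{}"])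
    then show ?thesis
      using expanding_action_graph_domain_of_expansion[OF assms(2)] *(2,3) BA
        measurably_equidecomposable_expanding by metis
  qed
  moreover have "set_equidecomposable G \<phi> A B \<and> B \<in> sets (completion M) \<and>
      emeasure (completion M) A = emeasure (completion M) B"
    if "measurably_equidecomposable G \<phi> M B A" for B
  proof -
    have *: "equidecomposable G \<phi> (sets (completion M)) B A"
      using that by (simp add: measurably_equidecomposable_def)
    then have "set_equidecomposable G \<phi> B A"
      unfolding set_equidecomposable_def by (rule c.equidecomposable_mono) simp
    then show ?thesis
      using c.measurable_equidecomposable_emeasure[OF *] c.set_equidecomposable_sym by simp
  qed
  ultimately show ?thesis by blast
qed

end
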